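(* Every connected graph $G$ having exactly two distance eigenvalues (counting multiplicity) different from $-1$ and $-3$ is determined by its distance spectrum; that is, for any connected graph $H$, $\mathrm{Spec}_D(H)=\mathrm{Spec}_D(G)$ implies $H\cong G$.
   Context: All graphs are finite and simple. For a connected graph $G$ with vertices $v_1,\ldots,v_n$, the distance matrix is $D(G)=(d(v_i,v_j))_{n\times n}$, where $d(v_i,v_j)$ is the length of a shortest path; the distance eigenvalues of $G$ are the eigenvalues of $D(G)$, and the distance spectrum $\mathrm{Spec}_D(G)$ is the multiset of distance eigenvalues (with multiplicities). *)

theory Defs
  imports
    "Graph_Theory.Digraph_Isomorphism"
    "Graph_Theory.Shortest_Path"
    "Jordan_Normal_Form.Char_Poly"
begin

text \<open>
  Finite simple graphs are rendered by the locale \<^locale>\<open>graph\<close>: symmetric, loop-free digraphs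
  without parallel arcs, on a finite vertex set.  An undirected path is a directed path of the
  symmetric digraph.
\<close>

definition graph_dist :: "('a, 'b) pre_digraph \<Rightarrow> 'a \<Rightarrow> 'a \<Rightarrow> nat" where
  "graph_dist G u v = (LEAST k. \<exists>p. pre_digraph.apath G u p v \<and> length p = k)"

definition vertex_enum :: "('a, 'b) pre_digraph \<Rightarrow> 'a list \<Rightarrow> bool" where
  "vertex_enum G vs \<longleftrightarrow> distinct vs \<and> set vs = verts G"

definition distance_matrix :: "('a, 'b) pre_digraph \<Rightarrow> 'a list \<Rightarrow> real mat" where
  "distance_matrix G vs =
     mat (length vs) (length vs) (\<lambda>(i, j). real (graph_dist G (vs ! i) (vs ! j)))"

text \<open>
  The eigenvalues are counted with algebraic multiplicity as roots of the characteristic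
  polynomial.  Real roots suffice, since the distance matrix of a graph is real symmetric.  The
  enumeration of the vertices is immaterial, by \<open>distance_spectrum_eq\<close> below.
\<close>
definition distance_spectrum :: "('a, 'b) pre_digraph \<Rightarrow> real multiset" where
  "distance_spectrum G = proots (char_poly (distance_matrix G (SOME vs. vertex_enum G vs)))"

lemma graph_dist_eq_mu:
  assumes G: "wf_digraph G" and reach: "u \<rightarrow>\<^sup>*\<^bsub>G\<^esub> v"
  shows "ereal (real (graph_dist G u v)) = wf_digraph.\<mu> G (\<lambda>_. 1) u v"
proof -
  interpret wf_digraph G by (rule G)
  have cost: "awalk_cost (\<lambda>_. 1) p = real (length p)" for p :: "'b list"
    by (induction p) auto
  let ?P = "\<lambda>k. \<exists>p. apath u p v \<and> length p = k"
  obtain p0 where "apath u p0 v"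
    using reach reachable_apath by blast
  then obtain p where p: "apath u p v" "length p = graph_dist G u v"
    using LeastI[of ?P "length p0"] unfolding graph_dist_def by blast
  have le: "graph_dist G u v \<le> length q" if q: "awalk u q v" for q
  proof -
    have "apath u (awalk_to_apath q) v" using q by (rule apath_awalk_to_apath)
    then have "graph_dist G u v \<le> length (awalk_to_apath q)"
      unfolding graph_dist_def by (intro Least_le) blast
    also have "\<dots> \<le> length q" using q
    proof (induct rule: awalk_to_apath_induct)
      case (path p)
      then have "awalk_to_apath p = p" by (auto simp: awalk_to_apath.simps)
      then show ?case by simp
    next
      case (decomp p q r s)
      then have "awalk_to_apath p = awalk_to_apath (q @ s)"
        using step_awalk_to_apath by metis
      moreover have "p = q @ r @ s" using decomp by (auto elim: awalk_cyc_decompE)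
      ultimately show ?case using decomp by auto
    qed
    finally show ?thesis .
  qed
  show ?thesis
    unfolding \<mu>_def
  proof (rule antisym)
    show "ereal (real (graph_dist G u v)) \<le> (INF p\<in>{p. awalk u p v}. ereal (awalk_cost (\<lambda>_. 1) p))"
      by (intro INF_greatest) (auto simp: cost le)
    show "(INF p\<in>{p. awalk u p v}. ereal (awalk_cost (\<lambda>_. 1) p)) \<le> ereal (real (graph_dist G u v))"
      using p by (intro INF_lower2[of p]) (auto simp: cost intro: awalkI_apath)
  qed
qed

lemma distance_spectrum_eq:
  assumes vs: "vertex_enum G vs"
  shows "distance_spectrum G = proots (char_poly (distance_matrix G vs))"
proof -
  define ws where "ws = (SOME vs. vertex_enum G vs)"
  have ws: "vertex_enum G ws"
    unfolding ws_def using vs by (rule someI)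
  define n where "n = length vs"
  have d: "distinct vs" "distinct ws" "set ws = set vs"
    using vs ws by (auto simp: vertex_enum_def)
  then have n: "length ws = n"
    unfolding n_def by (metis distinct_card)
  define P Q :: "real mat"
    where "P = mat n n (\<lambda>(i, j). if ws ! i = vs ! j then 1 else 0)"
      and "Q = mat n n (\<lambda>(i, j). if vs ! i = ws ! j then 1 else 0)"
  have "\<exists>j<n. vs ! j = ws ! i" if "i < n" for i
    using that d n by (metis in_set_conv_nth n_def)
  then obtain f where f: "\<And>i. i < n \<Longrightarrow> f i < n \<and> vs ! f i = ws ! i" by metis
  have "\<exists>j<n. ws ! j = vs ! i" if "i < n" for i
    using that d n by (metis in_set_conv_nth n_def)
  then obtain g where g: "\<And>i. i < n \<Longrightarrow> g i < n \<and> ws ! g i = vs ! i" by metis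
  have P: "P = mat n n (\<lambda>(i, j). if j = f i then 1 else 0)"
    unfolding P_def using f d n by (intro cong_mat) (auto simp: nth_eq_iff_index_eq n_def, metis nth_eq_iff_index_eq)
  have Q: "Q = mat n n (\<lambda>(i, j). if i = f j then 1 else 0)"
    unfolding Q_def using f d n by (intro cong_mat) (auto simp: nth_eq_iff_index_eq n_def, metis nth_eq_iff_index_eq)
  have P': "P = mat n n (\<lambda>(i, j). if i = g j then 1 else 0)"
    unfolding P_def using g d n by (intro cong_mat) (auto simp: nth_eq_iff_index_eq n_def, metis nth_eq_iff_index_eq)
  have Q': "Q = mat n n (\<lambda>(i, j). if j = g i then 1 else 0)"
    unfolding Q_def using g d n by (intro cong_mat) (auto simp: nth_eq_iff_index_eq n_def, metis nth_eq_iff_index_eq)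
  have inj: "f i = f j \<longleftrightarrow> i = j" "g i = g j \<longleftrightarrow> i = j" if "i < n" "j < n" for i j
    using f[OF that(1)] f[OF that(2)] g[OF that(1)] g[OF that(2)] d n that
    by (metis nth_eq_iff_index_eq n_def)+
  have delta: "(if b then 1 else 0) * x = (if b then x else 0)"
    "x * (if b then 1 else 0) = (if b then x else 0)" for b and x :: real by auto
  have "similar_mat_wit (distance_matrix G ws) (distance_matrix G vs) P Q"
  proof (rule similar_mat_witI[of _ _ n])
    show "P * Q = 1\<^sub>m n"
      unfolding P Q by (rule eq_matI) (auto simp: scalar_prod_def delta inj f)
    show "Q * P = 1\<^sub>m n"
      unfolding P' Q' by (rule eq_matI) (auto simp: scalar_prod_def delta inj g)
    show "distance_matrix G ws = P * distance_matrix G vs * Q"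
      unfolding P Q distance_matrix_def
      by (rule eq_matI) (auto simp: scalar_prod_def delta f n n_def[symmetric])
  qed (auto simp: P_def Q_def distance_matrix_def n n_def)
  then show ?thesis
    unfolding distance_spectrum_def ws_def[symmetric]
    by (metis char_poly_similar similar_mat_def)
qed

end

theory Submission
  imports Defs
begin

text \<open>
  Write $D + I = J + B$.  An isometric path on three vertices makes both exceptional eigenvalues
  larger than $-1$, so $D + 3I$ is positive semidefinite, $D + I$ has exactly two positive
  eigenvalues and $P = (D + I)(D + 3I)$ has rank two.  The first fact bounds the diameter by two, so
  that $B$ is the adjacency matrix of the complement; the second one excludes induced paths on four
  vertices, so that $B$ is disconnected by Seinsche's theorem.  The entries of $P$ are
  $n + 2 + b_u + b_v + c_{uv} + 2 B_{uv}$ with degrees $b$ and codegrees $c$ in $B$, and the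
  $3 \times 3$ minors of $P$ show first that nonadjacent vertices on one side of the disconnection
  are twins and then, by a small Diophantine analysis of the sizes of the twin classes, that $B$ is
  $K_{2,\dots,2} + s K_1$, $K_{2,\dots,2} + K_{2,\dots,2}$ or $K_{1,5} + K_{2,\dots,2}$.
  The order $n$ and the traces of $(D + I)^2$ and $(D + I)^3$ separate these graphs.
\<close>

section \<open>The spectral theorem for real symmetric matrices\<close>

text \<open>The hypothesis speaks of the spectrum alone, so it passes to \<open>H\<close>. Both
  graphs land in the same three families, and it need not be decided which members occur, because
  the order and the two traces, all read off the spectrum, already separate the members. The minors
  used have two vertices on one side of the disconnection and the third on the other: the mixed
  entries of P then contain only the order and degrees, and the determinant becomes a relation
  between three degrees and one codegree. The obstacle is an isolated third vertex, against which a
  nonadjacent pair consisting of an isolated and a non-isolated vertex also satisfies the relation;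
  this is why the isolated vertices are collected on a side of their own. Class sizes enter shifted
  by two, because two classes of size two solve the relation identically. K_{1,5} is the sporadic
  solution, and its rival K_{1,4} is excluded by divisibility. Signs of eigenvalues come from
  exhibiting vectors, orthogonal for a shifted distance form, on which this form is
  positive.\<close>

lemma real_symmetric_eigenvalue_exists:
  fixes A :: "real mat"
  assumes A: "A \<in> carrier_mat n n" and sym: "transpose_mat A = A" and n: "n > 0"
  obtains e where "eigenvalue A e"
proof -
  let ?h = "complex_of_real"
  let ?C = "map_mat ?h A"
  have C: "?C \<in> carrier_mat n n" using A by simp
  have "degree (char_poly ?C) = n" using degree_monic_char_poly[OF C] by simp
  then have "\<not> constant (poly (char_poly ?C))" using n by (simp add: constant_degree)
  then obtain z where z: "poly (char_poly ?C) z = 0"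
    using fundamental_theorem_of_algebra by blast
  then obtain v where v: "eigenvector ?C v z"
    using eigenvalue_root_char_poly[OF C] unfolding eigenvalue_def by blast
  then have v1: "v \<in> carrier_vec n" and v0: "v \<noteq> 0\<^sub>v n" and ev: "?C *\<^sub>v v = z \<cdot>\<^sub>v v"
    using A unfolding eigenvector_def by auto
  have sA: "A $$ (i, j) = A $$ (j, i)" if "i < n" "j < n" for i j
    using A sym that by (metis carrier_matD index_transpose_mat(1))
  have row: "(\<Sum>j<n. ?h (A $$ (i, j)) * v $ j) = z * v $ i" if "i < n" for i
    using arg_cong[OF ev, of "\<lambda>w. w $ i"] A v1 that
    by (simp add: scalar_prod_def atLeast0LessThan)
  have nv: "(\<Sum>i<n. cnj (v $ i) * v $ i) = ?h (\<Sum>i<n. (cmod (v $ i))\<^sup>2)"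
    by (simp add: complex_norm_square[symmetric] mult.commute)
  have "(\<Sum>i<n. (cmod (v $ i))\<^sup>2) \<noteq> 0"
  proof
    assume "(\<Sum>i<n. (cmod (v $ i))\<^sup>2) = 0"
    then have "v $ i = 0" if "i < n" for i
      using that by (subst (asm) sum_nonneg_eq_0_iff) auto
    then show False using v0 v1 by (auto intro: eq_vecI)
  qed
  then have s0: "(\<Sum>i<n. cnj (v $ i) * v $ i) \<noteq> 0" using nv by (metis of_real_eq_0_iff)
  \<comment> \<open>The Hermitian form of \<open>v\<close> under a real symmetric matrix equals its
    own conjugate and also \<open>z\<close> times the squared norm of \<open>v\<close>; hence
    \<open>z\<close> is real.\<close>
  let ?q = "\<Sum>i<n. \<Sum>j<n. cnj (v $ i) * (?h (A $$ (i, j)) * v $ j)"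
  have q: "?q = z * (\<Sum>i<n. cnj (v $ i) * v $ i)"
    by (simp add: row sum_distrib_left[symmetric]) (simp add: sum_distrib_left mult_ac)
  have "cnj ?q = (\<Sum>i<n. \<Sum>j<n. cnj (v $ j) * (?h (A $$ (j, i)) * v $ i))"
    by (auto simp: sA mult_ac intro!: sum.cong)
  also have "\<dots> = ?q" by (rule sum.swap)
  finally have "cnj z * (\<Sum>i<n. cnj (v $ i) * v $ i) = z * (\<Sum>i<n. cnj (v $ i) * v $ i)"
    unfolding q nv by simp
  then have "cnj z = z" using s0 by simp
  then have zr: "z = ?h (Re z)" by (simp add: complex_eq_iff)
  have "poly (map_poly ?h (char_poly A)) (?h (Re z)) = 0"
    using z zr of_real_hom.char_poly_hom[OF A, where 'a = complex] by simp
  then have "poly (char_poly A) (Re z) = 0"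
    by (simp add: of_real_hom.poly_map_poly)
  then show ?thesis using that eigenvalue_root_char_poly[OF A] by blast
qed

text \<open>The witness is a Householder reflection.\<close>
lemma orthogonal_symmetric_mat_first_col:
  fixes v :: "real vec"
  assumes v: "v \<in> carrier_vec n" and n: "n > 0" and unit: "v \<bullet> v = 1"
  obtains W where "W \<in> carrier_mat n n" "transpose_mat W = W" "W * W = 1\<^sub>m n"
    "W *\<^sub>v unit_vec n 0 = v"
proof (cases "v = unit_vec n 0")
  case True
  then show ?thesis using that[of "1\<^sub>m n"] n by auto
next
  case False
  let ?u = "unit_vec n 0 :: real vec"
  define w where "w = v - ?u"
  define s where "s = w \<bullet> w"
  have w: "w \<in> carrier_vec n" using v by (simp add: w_def)
  have wi: "w $ i = v $ i - (if i = 0 then 1 else 0)" if "i < n" for i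
    using that n v by (simp add: w_def)
  have ssum: "s = (\<Sum>i<n. w $ i * w $ i)"
    using w by (simp add: s_def scalar_prod_def atLeast0LessThan)
  have "s \<noteq> 0"
  proof
    assume "s = 0"
    then have "w $ i = 0" if "i < n" for i
      using that unfolding ssum by (subst (asm) sum_nonneg_eq_0_iff) auto
    then have "v = ?u" using wi v n by (intro eq_vecI) auto
    then show False using False by simp
  qed
  have vv: "(\<Sum>i<n. v $ i * v $ i) = 1"
    using unit v by (simp add: scalar_prod_def atLeast0LessThan)
  have dl: "(\<Sum>i<n. f i * (if i = 0 then 1 else 0)) = f 0" for f :: "nat \<Rightarrow> real"
    using n by (simp add: if_distrib[of "\<lambda>x. _ * x"] cong: if_cong)
  have "s = (\<Sum>i<n. v $ i * v $ i - 2 * (v $ i * (if i = 0 then 1 else 0)) + 1 * (if i = 0 then 1 else 0))"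
    unfolding ssum by (intro sum.cong) (auto simp: wi algebra_simps)
  also have "\<dots> = 2 - 2 * v $ 0"
    unfolding sum.distrib sum_subtractf sum_distrib_left[symmetric] vv dl using n by simp
  \<comment> \<open>Unit length of \<open>v\<close> turns the squared norm of \<open>w\<close> into
    \<open>- 2 * w $ 0\<close>. This is exactly what makes the reflection send the first unit vector
    e to e + w = v.\<close>
  finally have s2: "s = - 2 * w $ 0" using n by (simp add: wi)
  define W where "W = mat n n (\<lambda>(i, j). (if i = j then 1 else 0) - 2 * w $ i * w $ j / s)"
  have W: "W \<in> carrier_mat n n" by (simp add: W_def)
  show ?thesis
  proof (rule that[OF W])
    show "transpose_mat W = W"
      by (rule eq_matI) (auto simp: W_def)
    show "W * W = 1\<^sub>m n"
    proof (rule eq_matI)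
      fix i j assume "i < dim_row (1\<^sub>m n :: real mat)" "j < dim_col (1\<^sub>m n :: real mat)"
      then have ij: "i < n" "j < n" by auto
      define c where "c = 4 * w $ i * w $ j / s\<^sup>2"
      have "(W * W) $$ (i, j) = (\<Sum>k<n. ((if i = k then 1 else 0) - 2 * w $ i * w $ k / s)
        * ((if k = j then 1 else 0) - 2 * w $ k * w $ j / s))"
        using ij by (simp add: W_def scalar_prod_def atLeast0LessThan)
      also have "\<dots> = (\<Sum>k<n. (if k = i then (if i = j then 1 else 0) - 2 * w $ i * w $ j / s else 0)
         - (if k = j then 2 * w $ i * w $ j / s else 0)
         + c * (w $ k * w $ k))"
        using \<open>s \<noteq> 0\<close> by (intro sum.cong) (auto simp: c_def field_simps power2_eq_square)
      also have "\<dots> = (if i = j then 1 else 0) - 4 * w $ i * w $ j / s + c * s"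
        using ij unfolding ssum by (simp add: sum.distrib sum_subtractf sum_distrib_left)
      also have "\<dots> = (if i = j then 1 else 0)"
        using \<open>s \<noteq> 0\<close> by (simp add: c_def field_simps power2_eq_square)
      finally show "(W * W) $$ (i, j) = 1\<^sub>m n $$ (i, j)" using ij by simp
    qed (auto simp: W_def)
    show "W *\<^sub>v ?u = v"
    proof (rule eq_vecI)
      fix i assume "i < dim_vec v"
      then have i: "i < n" using v by simp
      have "(W *\<^sub>v ?u) $ i = (if i = 0 then 1 else 0) - 2 * w $ i * w $ 0 / s"
        using i n by (simp add: W_def scalar_prod_def unit_vec_def if_distrib[of "\<lambda>x. _ * x"]
            cong: if_cong)
      also have "\<dots> = (if i = 0 then 1 else 0) + w $ i"
        using \<open>s \<noteq> 0\<close> s2 by (simp add: field_simps)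
      finally show "(W *\<^sub>v ?u) $ i = v $ i" using i by (simp add: wi)
    qed (use v in \<open>auto simp: W_def\<close>)
  qed
qed

text \<open>Deflation: conjugation by the symmetric involution \<open>W\<close> moves a unit
  eigenvector to the first basis vector, symmetry then clears the first row together with the first
  column, and the induction hypothesis diagonalizes the remaining block.\<close>

lemma real_symmetric_mat_diagonalizable:
  fixes A :: "real mat"
  assumes "A \<in> carrier_mat n n" "transpose_mat A = A"
  shows "\<exists>U f. U \<in> carrier_mat n n \<and> transpose_mat U * U = 1\<^sub>m n \<and> U * transpose_mat U = 1\<^sub>m n
    \<and> A = U * mat_diag n f * transpose_mat U"
  using assms
proof (induction n arbitrary: A)
  case 0
  then show ?case by (intro exI[of _ "1\<^sub>m 0"] exI[of _ "\<lambda>_. 0"]) auto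
next
  case (Suc m)
  let ?n = "Suc m"
  note A = Suc.prems(1) and sym = Suc.prems(2)
  obtain e where "eigenvalue A e"
    using real_symmetric_eigenvalue_exists[OF A sym] by blast
  then obtain v0 where v0: "v0 \<in> carrier_vec ?n" "v0 \<noteq> 0\<^sub>v ?n" "A *\<^sub>v v0 = e \<cdot>\<^sub>v v0"
    using A unfolding eigenvalue_def eigenvector_def by auto
  have pos: "v0 \<bullet> v0 > 0"
  proof -
    have "v0 \<bullet> v0 = (\<Sum>i<?n. v0 $ i * v0 $ i)"
      using v0(1) by (simp add: scalar_prod_def atLeast0LessThan)
    moreover have "(\<Sum>i<?n. v0 $ i * v0 $ i) \<noteq> 0"
    proof
      assume "(\<Sum>i<?n. v0 $ i * v0 $ i) = 0"
      then have "v0 $ i = 0" if "i < ?n" for i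
        using that by (subst (asm) sum_nonneg_eq_0_iff) auto
      then show False using v0(1,2) by (auto intro: eq_vecI)
    qed
    moreover have "(\<Sum>i<?n. v0 $ i * v0 $ i) \<ge> 0" by (intro sum_nonneg) auto
    ultimately show ?thesis by linarith
  qed
  define v where "v = (1 / sqrt (v0 \<bullet> v0)) \<cdot>\<^sub>v v0"
  have v: "v \<in> carrier_vec ?n" using v0 by (simp add: v_def)
  have unit: "v \<bullet> v = 1"
    using v0(1) pos by (simp add: v_def field_simps)
  have ev: "A *\<^sub>v v = e \<cdot>\<^sub>v v"
    using mult_mat_vec[OF A v0(1)] v0(3) by (simp add: v_def smult_smult_assoc mult.commute)
  obtain W where W: "W \<in> carrier_mat ?n ?n" and Wt: "transpose_mat W = W"
    and WW: "W * W = 1\<^sub>m ?n" and Wu: "W *\<^sub>v unit_vec ?n 0 = v"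
    using orthogonal_symmetric_mat_first_col[OF v _ unit] by blast
  define A' where "A' = W * A * W"
  have A': "A' \<in> carrier_mat ?n ?n" using A W by (simp add: A'_def)
  have A't: "transpose_mat A' = A'"
    using A W sym Wt unfolding A'_def
    by (simp add: transpose_mult[of _ ?n ?n _ ?n] assoc_mult_mat[of _ ?n ?n _ ?n _ ?n])
  have Wv: "W *\<^sub>v v = unit_vec ?n 0"
    using Wu WW W by (metis assoc_mult_mat_vec one_mult_mat_vec unit_vec_carrier)
  have "A' *\<^sub>v unit_vec ?n 0 = W *\<^sub>v (A *\<^sub>v (W *\<^sub>v unit_vec ?n 0))"
    using A W by (simp add: A'_def assoc_mult_mat_vec[of _ ?n ?n _ ?n])
  also have "\<dots> = e \<cdot>\<^sub>v unit_vec ?n 0"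
    using W v by (simp add: Wu ev Wv mult_mat_vec[of _ ?n ?n])
  finally have eu: "A' *\<^sub>v unit_vec ?n 0 = e \<cdot>\<^sub>v unit_vec ?n 0" .
  have c0: "A' $$ (i, 0) = (if i = 0 then e else 0)" if "i < ?n" for i
  proof -
    have "(A' *\<^sub>v unit_vec ?n 0) $ i = A' $$ (i, 0)"
      using A' that by (simp add: scalar_prod_right_unit)
    then show ?thesis using eu that by (auto split: if_splits)
  qed
  have r0: "A' $$ (0, i) = (if i = 0 then e else 0)" if "i < ?n" for i
    using c0[OF that] A't A' that by (metis carrier_matD index_transpose_mat(1) zero_less_Suc)
  define B where "B = mat m m (\<lambda>(i, j). A' $$ (Suc i, Suc j))"
  have B: "B \<in> carrier_mat m m" by (simp add: B_def)
  have "transpose_mat B = B"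
  proof (rule eq_matI)
    fix i j assume "i < dim_row B" "j < dim_col B"
    then show "transpose_mat B $$ (i, j) = B $$ (i, j)"
      using A' A't unfolding B_def
      by simp (metis A' A't carrier_matD index_transpose_mat(1) Suc_less_eq)
  qed (auto simp: B_def)
  from Suc.IH[OF B this] obtain V g where V: "V \<in> carrier_mat m m"
    "transpose_mat V * V = 1\<^sub>m m" "V * transpose_mat V = 1\<^sub>m m"
    "B = V * mat_diag m g * transpose_mat V" by blast
  have A'B: "A' = four_block_mat (mat 1 1 (\<lambda>_. e)) (0\<^sub>m 1 m) (0\<^sub>m m 1) B"
    using A' by (intro eq_matI) (auto simp: c0 r0 B_def four_block_mat_def)
  define V' where "V' = four_block_mat (1\<^sub>m 1) (0\<^sub>m 1 m) (0\<^sub>m m 1) V"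
  have V': "V' \<in> carrier_mat ?n ?n" using V four_block_carrier_mat[of "1\<^sub>m 1" 1 1 V m m] by (simp add: V'_def)
  have V't: "transpose_mat V' = four_block_mat (1\<^sub>m 1) (0\<^sub>m 1 m) (0\<^sub>m m 1) (transpose_mat V)"
    using V by (simp add: V'_def transpose_four_block_mat[of _ 1 1 _ m _ m])
  define f where "f = (\<lambda>i. case i of 0 \<Rightarrow> e | Suc k \<Rightarrow> g k)"
  have diag: "mat_diag ?n f = four_block_mat (mat 1 1 (\<lambda>_. e)) (0\<^sub>m 1 m) (0\<^sub>m m 1) (mat_diag m g)"
    by (rule eq_matI) (auto simp: four_block_mat_def mat_diag_def f_def split: nat.splits)
  note mb = mult_four_block_mat[of _ 1 1 _ m _ m _ _ 1 _ m]
  have 1: "transpose_mat V' * V' = 1\<^sub>m ?n" "V' * transpose_mat V' = 1\<^sub>m ?n"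
    unfolding V't unfolding V'_def using V by (simp_all add: mb plus_1_eq_Suc del: One_nat_def)
  have VD: "V * mat_diag m g \<in> carrier_mat m m" "V * mat_diag m g * transpose_mat V \<in> carrier_mat m m"
    using V by auto
  have A'V: "A' = V' * mat_diag ?n f * transpose_mat V'"
    unfolding V't unfolding V'_def diag using V VD
    by (simp add: mb A'B left_mult_zero_mat[of _ m m] right_mult_zero_mat[OF VD(1)] del: One_nat_def)
  let ?L = "mat_diag ?n f"
  have L: "?L \<in> carrier_mat ?n ?n" by simp
  note as = assoc_mult_mat[of _ ?n ?n _ ?n _ ?n]
  define U where "U = W * V'"
  have Ut: "transpose_mat U = transpose_mat V' * W"
    using W V' Wt by (simp add: U_def transpose_mult[of _ ?n ?n _ ?n])
  have U: "U \<in> carrier_mat ?n ?n" using W V' by (simp add: U_def)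
  have "transpose_mat U * U = transpose_mat V' * ((W * W) * V')"
    unfolding Ut unfolding U_def using W V' by (simp add: as)
  also have "\<dots> = 1\<^sub>m ?n" using V' 1 by (simp add: WW)
  finally have u1: "transpose_mat U * U = 1\<^sub>m ?n" .
  have "U * transpose_mat U = W * ((V' * transpose_mat V') * W)"
    unfolding Ut unfolding U_def using W V' by (simp add: as)
  also have "\<dots> = 1\<^sub>m ?n" using W 1 by (simp add: WW)
  finally have u2: "U * transpose_mat U = 1\<^sub>m ?n" .
  have "A = (W * W) * A * (W * W)" using A W by (simp add: WW)
  also have "\<dots> = W * A' * W" using A W unfolding A'_def by (simp add: as)
  also have "\<dots> = U * ?L * transpose_mat U"
  proof -
    have 2: "W * (V * L * T) * W = W * V * L * (T * W)"
      if "V \<in> carrier_mat ?n ?n" "L \<in> carrier_mat ?n ?n" "T \<in> carrier_mat ?n ?n" for V L T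
      using W that by (simp add: as mult_carrier_mat[of _ ?n ?n _ ?n])
    show ?thesis
      unfolding Ut unfolding U_def A'V by (rule 2) (use V' L in auto)
  qed
  finally show ?case using U u1 u2 by blast
qed

text \<open>The sums are the entries of A = U diag(e) U^T, of U U^T = I and of U^T U = I. In this
  form all later spectral arguments are manipulations of finite sums, and \<open>e\<close> lists the
  spectrum with multiplicity.\<close>

lemma real_symmetric_spectral_decomposition:
  fixes a :: "nat \<Rightarrow> nat \<Rightarrow> real"
  assumes sym: "\<forall>i<n. \<forall>j<n. a i j = a j i"
  shows "\<exists>U e. proots (char_poly (mat n n (\<lambda>(i, j). a i j))) = image_mset e (mset_set {..<n}) \<and>
    (\<forall>x<n. \<forall>y<n. a x y = (\<Sum>i<n. e i * U x i * U y i) \<and>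
      (\<Sum>i<n. U x i * U y i) = (if x = y then 1 else 0 :: real) \<and>
      (\<Sum>z<n. U z x * U z y) = (if x = y then 1 else 0 :: real))"
proof -
  let ?A = "mat n n (\<lambda>(i, j). a i j)"
  have A: "?A \<in> carrier_mat n n" by simp
  have "transpose_mat ?A = ?A" by (rule eq_matI) (auto simp: sym)
  then obtain U f where U: "U \<in> carrier_mat n n" "transpose_mat U * U = 1\<^sub>m n"
    "U * transpose_mat U = 1\<^sub>m n" "?A = U * mat_diag n f * transpose_mat U"
    using real_symmetric_mat_diagonalizable[OF A] by blast
  have D: "mat_diag n f \<in> carrier_mat n n" by simp
  have "similar_mat_wit ?A (mat_diag n f) U (transpose_mat U)"
    by (rule similar_mat_witI[of _ _ n]) (use U in auto)
  then have "char_poly ?A = char_poly (mat_diag n f)"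
    using char_poly_similar similar_mat_def by blast
  also have "\<dots> = (\<Prod>x\<leftarrow>diag_mat (mat_diag n f). [:- x, 1:])"
    by (rule char_poly_upper_triangular[OF D]) (auto simp: mat_diag_def)
  also have "diag_mat (mat_diag n f) = map f [0..<n]"
    by (auto simp: diag_mat_def mat_diag_def)
  also have "proots (\<Prod>x\<leftarrow>map f [0..<n]. [:- x, 1:]) = mset (map f [0..<n])"
  proof (induction n)
    case (Suc n)
    have "(\<Prod>x\<leftarrow>map f [0..<n]. [:- x, 1:]) \<noteq> 0" by (auto simp: prod_list_zero_iff)
    then show ?case using Suc by (simp add: proots_mult del: mult_pCons_right)
  qed simp
  also have "\<dots> = image_mset f (mset_set {..<n})"
    by (simp add: lessThan_atLeast0)
  finally have 1: "proots (char_poly ?A) = image_mset f (mset_set {..<n})" .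
  show ?thesis
  proof (intro exI[of _ "\<lambda>x i. U $$ (x, i)"] exI[of _ f] conjI allI impI)
    show "proots (char_poly ?A) = image_mset f (mset_set {..<n})" by (fact 1)
  next
    fix x y assume xy: "x < n" "y < n"
    have "a x y = ?A $$ (x, y)" using xy by simp
    also have "\<dots> = (U * mat_diag n f * transpose_mat U) $$ (x, y)" using U(4) by simp
    also have "\<dots> = (\<Sum>i<n. f i * U $$ (x, i) * U $$ (y, i))"
      using U(1) xy by (simp add: mat_diag_mult_right[of _ n n] scalar_prod_def atLeast0LessThan mult_ac)
    finally show "a x y = (\<Sum>i<n. f i * U $$ (x, i) * U $$ (y, i))" .
    show "(\<Sum>i<n. U $$ (x, i) * U $$ (y, i)) = (if x = y then 1 else 0)"
      using arg_cong[OF U(3), of "\<lambda>M. M $$ (x, y)"] U(1) xy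
      by (simp add: scalar_prod_def atLeast0LessThan)
    show "(\<Sum>z<n. U $$ (z, x) * U $$ (z, y)) = (if x = y then 1 else 0)"
      using arg_cong[OF U(2), of "\<lambda>M. M $$ (x, y)"] U(1) xy
      by (simp add: scalar_prod_def atLeast0LessThan)
  qed
qed

section \<open>Relations without an induced path on four vertices\<close>

definition P4_free :: "'a set \<Rightarrow> ('a \<Rightarrow> 'a \<Rightarrow> bool) \<Rightarrow> bool" where
  "P4_free V R \<longleftrightarrow> (\<forall>a\<in>V. \<forall>b\<in>V. \<forall>c\<in>V. \<forall>d\<in>V. distinct [a, b, c, d] \<longrightarrow>
     R a b \<longrightarrow> R b c \<longrightarrow> R c d \<longrightarrow> R a c \<or> R b d \<or> R a d)"

text \<open>For symmetric \<open>R\<close> this is disconnectedness of the graph on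
  \<open>V\<close>. A bipartition is what the insertion step of Seinsche's theorem modifies and what
  the structure analysis starts from.\<close>

definition splits :: "'a set \<Rightarrow> ('a \<Rightarrow> 'a \<Rightarrow> bool) \<Rightarrow> bool" where
  "splits V R \<longleftrightarrow> (\<exists>X Y. X \<union> Y = V \<and> X \<inter> Y = {} \<and> X \<noteq> {} \<and> Y \<noteq> {} \<and> (\<forall>x\<in>X. \<forall>y\<in>Y. \<not> R x y))"

lemma splitsI:
  "X \<union> Y = V \<Longrightarrow> X \<inter> Y = {} \<Longrightarrow> X \<noteq> {} \<Longrightarrow> Y \<noteq> {} \<Longrightarrow> (\<And>x y. x \<in> X \<Longrightarrow> y \<in> Y \<Longrightarrow> \<not> R x y) \<Longrightarrow> splits V R"
  unfolding splits_def by blast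

lemma P4_free_complement:
  assumes sym: "\<And>x y. R x y \<longleftrightarrow> R y x" and "P4_free V R"
  shows "P4_free V (\<lambda>x y. x \<noteq> y \<and> \<not> R x y)"
  unfolding P4_free_def
proof (intro ballI impI)
  fix a b c d assume *: "a \<in> V" "b \<in> V" "c \<in> V" "d \<in> V" "distinct [a, b, c, d]"
    "a \<noteq> b \<and> \<not> R a b" "b \<noteq> c \<and> \<not> R b c" "c \<noteq> d \<and> \<not> R c d"
  \<comment> \<open>A path on four vertices is self-complementary: the complement of the path a b c
    d is the path b d a c.\<close>
  have "distinct [b, d, a, c]" using * by auto
  then have "R b d \<longrightarrow> R d a \<longrightarrow> R a c \<longrightarrow> R b a \<or> R d c \<or> R b c"
    using assms(2) * unfolding P4_free_def by blast
  then show "a \<noteq> c \<and> \<not> R a c \<or> b \<noteq> d \<and> \<not> R b d \<or> a \<noteq> d \<and> \<not> R a d"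
    using * sym by auto
qed

text \<open>If \<open>v\<close> has neighbours on at most one side, it joins that side. If it is
  adjacent to all of \<open>W\<close>, it is isolated in the complement. Otherwise it has a
  non-neighbour on one side and a neighbour on the other, and \<open>main\<close> cuts off the
  non-neighbours of \<open>v\<close> on the former side.\<close>

lemma P4_free_splits_insert:
  assumes sym: "\<And>x y. R x y \<longleftrightarrow> R y x"
    and P4: "P4_free (insert v W) R" and v: "v \<notin> W" and W: "splits W R"
  shows "splits (insert v W) R \<or> splits (insert v W) (\<lambda>x y. x \<noteq> y \<and> \<not> R x y)"
proof -
  obtain X Y where XY: "X \<union> Y = W" "X \<inter> Y = {}" "X \<noteq> {}" "Y \<noteq> {}"
    and no: "\<And>x y. x \<in> X \<Longrightarrow> y \<in> Y \<Longrightarrow> \<not> R x y"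
    using W unfolding splits_def by blast
  have symD: "R y x" if "R x y" for x y using that sym by blast
  have main: "splits (insert v W) R"
    if XY: "X \<union> Y = W" "X \<inter> Y = {}" "X \<noteq> {}" "Y \<noteq> {}"
      and no: "\<And>x y. x \<in> X \<Longrightarrow> y \<in> Y \<Longrightarrow> \<not> R x y"
      and a: "a \<in> X" "\<not> R v a" and z: "z \<in> Y" "R v z" for X Y a z
  proof -
    let ?O = "{x \<in> X. \<not> R v x}"
    \<comment> \<open>An edge from a non-neighbour \<open>x\<close> of \<open>v\<close> to a
      neighbour \<open>y\<close> of \<open>v\<close> in \<open>X\<close> would make z v y x an
      induced path, as \<open>z\<close> lies on the other side.\<close>
    have "\<not> R x y" if x: "x \<in> ?O" and y: "y \<in> X" "R v y" for x y
    proof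
      assume xy: "R x y"
      have "distinct [z, v, y, x]" using x y z XY v by auto
      moreover have "{z, v, y, x} \<subseteq> insert v W" using x y z XY by auto
      ultimately have "R z v \<longrightarrow> R v y \<longrightarrow> R y x \<longrightarrow> R z y \<or> R v x \<or> R z x"
        using P4 unfolding P4_free_def by blast
      moreover have "R z v" "R y x" "\<not> R z y" "\<not> R z x"
        using symD[OF z(2)] symD[OF xy] no[OF y(1) z(1)] no[OF _ z(1), of x] symD[of z y] symD[of z x] x
        by fast+
      moreover have "\<not> R v x" "R v y" using x y by blast+
      ultimately show False by blast
    qed
    note O = this
    show ?thesis
    proof (intro splitsI[of ?O "insert v (W - ?O)"])
      show "\<not> R x y" if x': "x \<in> ?O" and y: "y \<in> insert v (W - ?O)" for x y
      proof -
        have x: "x \<in> X" "\<not> R v x" using x' by auto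
        consider "y = v" | "y \<in> Y" | "y \<in> X" "R v y" using y XY(1) by blast
        then show ?thesis
        proof cases
          case 1
          then show ?thesis using x symD[of x v] by blast
        next
          case 2
          then show ?thesis using x no[of x y] by blast
        next
          case 3
          then show ?thesis using O[OF x'] by blast
        qed
      qed
    qed (use XY a v in auto)
  qed
  show ?thesis
  proof (cases "(\<exists>x\<in>X. R v x) \<and> (\<exists>y\<in>Y. R v y)")
    case False
    then show ?thesis
    proof (cases "\<exists>x\<in>X. R v x")
      case True
      then have "splits (insert v W) R"
      proof (intro splitsI[of Y "insert v X"])
        show "\<not> R x y" if "x \<in> Y" "y \<in> insert v X" for x y
          using that no[of y x] symD[of x y] False True symD[of x v] by blast
      qed (use XY v in auto)
      then show ?thesis ..
    next
      case F: False
      then have "splits (insert v W) R"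
      proof (intro splitsI[of X "insert v Y"])
        show "\<not> R x y" if "x \<in> X" "y \<in> insert v Y" for x y
          using that no[of x y] F symD[of x v] by blast
      qed (use XY v in auto)
      then show ?thesis ..
    qed
  next
    case True
    then obtain x y where xy: "x \<in> X" "R v x" "y \<in> Y" "R v y" by blast
    show ?thesis
    proof (cases "\<forall>z\<in>W. R v z")
      case True
      then have "splits (insert v W) (\<lambda>x y. x \<noteq> y \<and> \<not> R x y)"
        by (intro splitsI[of "{v}" W]) (use XY v in auto)
      then show ?thesis ..
    next
      case False
      then obtain a where "a \<in> W" "\<not> R v a" by blast
      then consider "a \<in> X" | "a \<in> Y" using XY by blast
      then have "splits (insert v W) R"
      proof cases
        case 1
        show ?thesis by (rule main[of X Y a y]) (use XY no 1 xy \<open>\<not> R v a\<close> in auto)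
      next
        case 2
        have "\<not> R y x" if "y \<in> Y" "x \<in> X" for x y using that no[of x y] symD[of y x] by blast
        then show ?thesis
          by (intro main[of Y X a x]) (use XY 2 xy \<open>\<not> R v a\<close> in auto)
      qed
      then show ?thesis ..
    qed
  qed
qed

text \<open>Seinsche's theorem.\<close>
lemma P4_free_splits:
  fixes R :: "'a \<Rightarrow> 'a \<Rightarrow> bool"
  assumes "finite V" "card V \<ge> 2" and sym: "\<And>x y. R x y \<longleftrightarrow> R y x" and "P4_free V R"
  shows "splits V R \<or> splits V (\<lambda>x y. x \<noteq> y \<and> \<not> R x y)"
  using assms(1,2,4)
proof (induction V rule: finite_induct)
  case (insert v W)
  have P4W: "P4_free W R" using insert.prems(2) unfolding P4_free_def by blast
  show ?case
  proof (cases "card W \<ge> 2")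
    case False
    then have "card W = 1" using insert by simp
    then obtain w where "W = {w}" by (auto simp: card_1_singleton_iff)
    moreover from this have "v \<noteq> w" using insert.hyps by simp
    moreover have "splits {v, w} R" if "\<not> R v w"
      by (rule splitsI[of "{v}" "{w}"]) (use that \<open>v \<noteq> w\<close> in auto)
    moreover have "splits {v, w} (\<lambda>x y. x \<noteq> y \<and> \<not> R x y)" if "R v w"
      by (rule splitsI[of "{v}" "{w}"]) (use that \<open>v \<noteq> w\<close> in auto)
    ultimately show ?thesis by (cases "R v w") auto
  next
    case True
    let ?C = "\<lambda>x y. x \<noteq> y \<and> \<not> R x y"
    from insert.IH[OF True P4W] show ?thesis
    proof
      assume "splits W R"
      then show ?thesis
        by (rule P4_free_splits_insert[OF sym insert.prems(2) insert.hyps(2)])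
    next
      assume C: "splits W ?C"
      have "splits (insert v W) ?C \<or> splits (insert v W) (\<lambda>x y. x \<noteq> y \<and> \<not> ?C x y)"
      proof (rule P4_free_splits_insert)
        show "?C x y \<longleftrightarrow> ?C y x" for x y using sym[of x y] by auto
      qed (use P4_free_complement[OF sym insert.prems(2)] insert.hyps(2) C in blast)+
      \<comment> \<open>The double complement differs from \<open>R\<close> only on the diagonal,
        which disjoint sides never meet.\<close>
      moreover have "splits (insert v W) R" if CC: "splits (insert v W) (\<lambda>x y. x \<noteq> y \<and> \<not> ?C x y)"
      proof -
        obtain X Y where XY: "X \<union> Y = insert v W" "X \<inter> Y = {}" "X \<noteq> {}" "Y \<noteq> {}"
          and no: "\<forall>x\<in>X. \<forall>y\<in>Y. \<not> (x \<noteq> y \<and> \<not> ?C x y)"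
          using CC unfolding splits_def by meson
        show ?thesis by (rule splitsI[OF XY]) (use XY(2) no in fast)
      qed
      ultimately show ?thesis by blast
    qed
  qed
qed simp

section \<open>Relations of rank two\<close>

locale vertex_relation =
  fixes V :: "'a set" and B :: "'a \<Rightarrow> 'a \<Rightarrow> bool"
  assumes finite_V: "finite V"
    and sym: "B x y \<longleftrightarrow> B y x"
    and irrefl: "\<not> B x x"
    and in_V: "B x y \<Longrightarrow> x \<in> V"
begin

definition nb :: "'a \<Rightarrow> 'a set" where "nb x = {y. B x y}"
definition deg :: "'a \<Rightarrow> nat" where "deg x = card (nb x)"
definition codeg :: "'a \<Rightarrow> 'a \<Rightarrow> nat" where "codeg x y = card (nb x \<inter> nb y)"

lemma in_V': "B x y \<Longrightarrow> y \<in> V" using in_V sym by blast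
lemma nb_V: "nb x \<subseteq> V" using in_V' by (auto simp: nb_def)
lemma finite_nb [simp]: "finite (nb x)" using nb_V finite_V finite_subset by blast
lemma deg_0_iff: "deg x = 0 \<longleftrightarrow> nb x = {}" by (simp add: deg_def)
lemma codeg_le: "codeg x y \<le> deg x" "codeg x y \<le> deg y"
  unfolding codeg_def deg_def by (auto intro: card_mono)

text \<open>The entries of $(D + I)(D + 3I)$ when $D = J - I + B$.\<close>
definition gram :: "'a \<Rightarrow> 'a \<Rightarrow> real" where
  "gram x y = card V + 2 + deg x + deg y + codeg x y + (if B x y then 2 else 0)"

lemma gram_self: "gram x x = card V + 2 + 3 * deg x"
  by (simp add: gram_def irrefl codeg_def deg_def)

end

locale rank_two_relation = vertex_relation +
  assumes gram_rank: "\<exists>p q v w. \<forall>x\<in>V. \<forall>y\<in>V. gram x y = p * v x * v y + q * w x * w y"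
begin

text \<open>The left-hand side is the expanded determinant of a symmetric 3 x 3 submatrix of
  \<open>gram\<close>. The rank hypothesis enters the combinatorics only in this form.\<close>

lemma gram_det:
  assumes "x \<in> V" "y \<in> V" "z \<in> V"
  shows "gram x x * gram y y * gram z z + 2 * gram x y * gram y z * gram x z
    - gram x x * (gram y z)\<^sup>2 - gram y y * (gram x z)\<^sup>2 - gram z z * (gram x y)\<^sup>2 = 0"
proof -
  obtain p q v w where *: "\<forall>x\<in>V. \<forall>y\<in>V. gram x y = p * v x * v y + q * w x * w y"
    using gram_rank by blast
  have "gram s t = p * v s * v t + q * w s * w t" if "s \<in> {x,y,z}" "t \<in> {x,y,z}" for s t
    using * that assms by auto
  note g = this
  show ?thesis by (simp add: g) Groebner_Basis.algebra
qed


text \<open>The difference of the two sides is precisely the determinant of \<open>gram_det\<close>.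
  Since \<open>k\<close> absorbs both the codegree and the extra 2 of an edge, one formula serves
  adjacent and nonadjacent pairs \<open>x\<close>, \<open>y\<close>.\<close>

lemma gram_det_no_common:
  fixes m k :: real
  assumes x: "x \<in> V" "y \<in> V" "z \<in> V"
    and "\<not> B x z" "\<not> B y z" "codeg x z = 0" "codeg y z = 0"
  defines "m \<equiv> real (card V) + 2" and "k \<equiv> codeg x y + (if B x y then 2 else 0 :: real)"
  shows "(m + 15 * deg z) * (deg x * deg y - k\<^sup>2)
    = (deg x + deg y - 2 * k) * (deg x * deg y + deg z * (deg x + deg y) + 6 * deg z * k
      + (deg z)\<^sup>2 - m * deg z)"
proof -
  have "gram x x = m + 3 * deg x" "gram y y = m + 3 * deg y" "gram z z = m + 3 * deg z"
    by (simp_all add: gram_self m_def)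
  moreover have "gram x y = m + deg x + deg y + k"
    by (simp add: gram_def m_def k_def)
  moreover have "gram x z = m + deg x + deg z" "gram y z = m + deg y + deg z"
    using assms by (simp_all add: gram_def)
  ultimately show ?thesis using gram_det[OF x] by simp Groebner_Basis.algebra
qed

end

text \<open>
  In the equation of \<open>gram_det_no_common\<close>, the vertices have degrees $k + x$, $k + y$ and $\beta$;
  counting closed neighbourhoods shows that the slack $\rho$ in the order is nonnegative.
\<close>
lemma nonadjacent_arith:
  fixes x y k \<beta> \<rho> :: real
  assumes nn: "x \<ge> 0" "y \<ge> 0" "k \<ge> 0" "\<beta> \<ge> 0" "\<rho> \<ge> 0"
    and eq: "((k + x + y + \<beta> + 5 + \<rho>) + 15 * \<beta>) * ((k + x) * (k + y) - k\<^sup>2)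
    = ((k + x) + (k + y) - 2 * k) * ((k + x) * (k + y) + \<beta> * ((k + x) + (k + y)) + 6 * \<beta> * k
      + \<beta>\<^sup>2 - (k + x + y + \<beta> + 5 + \<rho>) * \<beta>)"
  shows "x = 0 \<and> y = 0 \<or> \<beta> = 0 \<and> k = 0 \<and> (x = 0 \<or> y = 0)"
proof -
  \<comment> \<open>Everything is moved to one side and grouped so that each summand is nonnegative;
    a zero sum then kills every summand separately.\<close>
  have "k * x * y + (9 * \<beta> + 5 + \<rho>) * k * (x + y) + (16 * \<beta> + 5 + \<rho>) * x * y + (5 + \<rho>) * \<beta> * (x + y) = 0"
    using eq by Groebner_Basis.algebra
  moreover have "k * x * y \<ge> 0" "(9 * \<beta> + 5 + \<rho>) * k * (x + y) \<ge> 0" "(16 * \<beta> + 5 + \<rho>) * x * y \<ge> 0"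
    "(5 + \<rho>) * \<beta> * (x + y) \<ge> 0"
    using nn by auto
  ultimately have "(9 * \<beta> + 5 + \<rho>) * k * (x + y) = 0" "(16 * \<beta> + 5 + \<rho>) * x * y = 0"
    "(5 + \<rho>) * \<beta> * (x + y) = 0"
    by linarith+
  then show ?thesis using nn by auto
qed

text \<open>
  Here $a + 2$, $b + 2$ and $\tau$ are sizes of twin classes and $R - 2$ is the number of remaining
  vertices on the side of the first two classes, see \<open>part_size_identity\<close>.
\<close>
lemma adjacent_arith:
  fixes a b R \<tau> \<beta> :: int
  assumes "a \<ge> -1" "b \<ge> -1" "R \<ge> 2" "\<tau> \<ge> 1" "\<beta> \<ge> 0"
    and eq: "(a + b) * ((4 + \<tau>) * (R + \<beta>) + 9 * \<beta> * R) + a * b * (R + 4 + \<tau> + 16 * \<beta>) = 0"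
  shows "a = 0 \<and> b = 0 \<or> a = -1 \<and> b \<ge> 1 \<or> a \<ge> 1 \<and> b = -1"
proof -
  let ?P = "(4 + \<tau>) * (R + \<beta>) + 9 * \<beta> * R" and ?Q = "R + 4 + \<tau> + 16 * \<beta>"
  have bR: "\<beta> * R \<ge> 2 * \<beta>" using assms mult_left_mono[of 2 R \<beta>] by simp
  have tR: "\<tau> * R \<ge> 2 * \<tau>" using assms mult_left_mono[of 2 R \<tau>] by simp
  have tb: "\<tau> * \<beta> \<ge> 0" using assms by simp
  \<comment> \<open>The middle estimate excludes \<open>a = b = -1\<close>, where the equation would
    read \<open>?Q = 2 * ?P\<close>.\<close>
  have P: "?P > 0" "2 * ?P > ?Q" "?Q > 0"
  proof -
    have "?P = 4 * R + 4 * \<beta> + \<tau> * R + \<tau> * \<beta> + 9 * (\<beta> * R)" by (simp add: algebra_simps)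
    note P = this
    show "?P > 0" unfolding P unfolding distrib_left using bR tR tb assms(3-5) by linarith
    show "2 * ?P > ?Q" unfolding P unfolding distrib_left using bR tR tb assms(3-5) by linarith
    show "?Q > 0" using assms by linarith
  qed
  consider "a = -1" "b = -1" | "a = -1" "b = 0" | "a = 0" "b = -1" | "a = -1" "b \<ge> 1" | "a \<ge> 1" "b = -1"
    | "a \<ge> 0" "b \<ge> 0" using assms by linarith
  then show ?thesis
  proof cases
    case 6
    have "(a + b) * ?P \<ge> 0" "a * b * ?Q \<ge> 0" using 6 P assms by auto
    then have "(a + b) * ?P = 0" using eq by linarith
    then show ?thesis using 6 P by auto
  qed (use eq P in auto)
qed

text \<open>This is the equation of \<open>adjacent_arith\<close> for \<open>a = -1\<close> and
  \<open>R = 2\<close>: the first class is the centre of a star without further vertices, and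
  \<open>b + 2\<close> counts its leaves. The first solution is K_{1,5}; the second, K_{1,4}, has to
  be refuted by information about the other side.\<close>

lemma star_arith:
  fixes b \<tau> \<beta> :: int
  assumes "b \<ge> 1" "\<tau> \<ge> 1" "\<beta> \<ge> 0"
    and eq: "(b - 1) * ((4 + \<tau>) * (2 + \<beta>) + 9 * \<beta> * 2) - b * (2 + 4 + \<tau> + 16 * \<beta>) = 0"
  shows "b = 3 \<and> \<tau> = 2 \<or> b = 2 \<and> \<beta> * (\<tau> - 10) = 4"
proof -
  have eq': "b * (2 + \<tau> + 6 * \<beta> + \<tau> * \<beta>) = 8 + 2 * \<tau> + 22 * \<beta> + \<tau> * \<beta>"
    using eq by (simp add: algebra_simps)
  have tb: "\<tau> * \<beta> \<ge> 0" using assms by simp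
  have "b < 4"
  proof (rule ccontr)
    assume "\<not> b < 4"
    then have "b * (2 + \<tau> + 6 * \<beta> + \<tau> * \<beta>) \<ge> 4 * (2 + \<tau> + 6 * \<beta> + \<tau> * \<beta>)"
      using assms by (intro mult_right_mono) auto
    then show False using eq' tb assms(2,3) unfolding distrib_left by linarith
  qed
  then consider "b = 1" | "b = 2" | "b = 3" using assms by linarith
  then show ?thesis
  proof cases
    case 1
    then show ?thesis using eq' tb assms by simp
  next
    case 2
    then show ?thesis using eq' by (simp add: algebra_simps)
  next
    case 3
    then have "(\<tau> - 2) * (1 + 2 * \<beta>) = 0" using eq' by (simp add: algebra_simps)
    then show ?thesis using 3 assms by auto
  qed
qed

section \<open>Twin classes\<close>

text \<open>Cocktail party graphs: complements of perfect matchings.\<close>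
definition cocktail :: "('a \<Rightarrow> 'a \<Rightarrow> bool) \<Rightarrow> 'a set \<Rightarrow> bool" where
  "cocktail B S \<longleftrightarrow> (\<forall>u\<in>S. \<exists>u'\<in>S. u' \<noteq> u \<and> (\<forall>z\<in>S. B u z \<longleftrightarrow> z \<noteq> u \<and> z \<noteq> u'))"

definition edgeless :: "('a \<Rightarrow> 'a \<Rightarrow> bool) \<Rightarrow> 'a set \<Rightarrow> bool" where
  "edgeless B S \<longleftrightarrow> (\<forall>u\<in>S. \<forall>v\<in>S. \<not> B u v)"

definition star :: "('a \<Rightarrow> 'a \<Rightarrow> bool) \<Rightarrow> 'a set \<Rightarrow> bool" where
  "star B S \<longleftrightarrow> (\<exists>a\<in>S. \<forall>u\<in>S. \<forall>v\<in>S. B u v \<longleftrightarrow> (u = a) \<noteq> (v = a))"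

context vertex_relation begin

definition parts :: "'a set \<Rightarrow> 'a set \<Rightarrow> bool" where
  "parts X Y \<longleftrightarrow> X \<union> Y = V \<and> X \<inter> Y = {} \<and> X \<noteq> {} \<and> Y \<noteq> {} \<and> (\<forall>x\<in>X. \<forall>y\<in>Y. \<not> B x y)"

text \<open>Nonadjacency is then transitive on \<open>X\<close>, so on a side of a disconnection
  \<open>B\<close> is complete multipartite.\<close>

definition twins :: "'a set \<Rightarrow> bool" where
  "twins X \<longleftrightarrow> (\<forall>u\<in>X. \<forall>v\<in>X. \<not> B u v \<longrightarrow> nb u = nb v)"

text \<open>Contains \<open>u\<close> itself. On a set of twins this is the twin class of
  \<open>u\<close>, and its size is the parameter of the Diophantine analysis.\<close>

definition non_nb :: "'a set \<Rightarrow> 'a \<Rightarrow> 'a set" where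
  "non_nb S u = {z \<in> S. \<not> B u z}"

lemma parts_sym: "parts X Y \<longleftrightarrow> parts Y X"
  unfolding parts_def using sym by (metis Int_commute Un_commute)

lemma parts_finite: "parts X Y \<Longrightarrow> finite X \<and> finite Y"
  using finite_V unfolding parts_def by (metis finite_Un)

lemma parts_card: "parts X Y \<Longrightarrow> card V = card X + card Y"
  using parts_finite[of X Y] unfolding parts_def by (metis card_Un_disjoint)

lemma parts_nb: "parts X Y \<Longrightarrow> u \<in> X \<Longrightarrow> nb u \<subseteq> X"
  using in_V' unfolding parts_def nb_def by blast

lemma parts_no_common:
  assumes "parts X Y" "u \<in> X" "w \<in> Y"
  shows "\<not> B u w" "codeg u w = 0"
proof -
  have "parts Y X" using assms(1) parts_sym[of X Y] by simp
  then have "nb w \<subseteq> Y" using assms(3) parts_nb by blast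
  moreover have "X \<inter> Y = {}" using assms(1) by (simp add: parts_def)
  ultimately have "nb u \<inter> nb w = {}"
    using parts_nb[OF assms(1,2)] by blast
  then show "codeg u w = 0" by (simp add: codeg_def)
  show "\<not> B u w" using assms unfolding parts_def by blast
qed

lemma deg_non_nb:
  assumes "parts X Y" "u \<in> X"
  shows "deg u + card (non_nb X u) = card X"
proof -
  have "X = nb u \<union> non_nb X u" "nb u \<inter> non_nb X u = {}"
    using parts_nb[OF assms] by (auto simp: nb_def non_nb_def)
  then show ?thesis unfolding deg_def
    using card_Un_disjoint[of "nb u" "non_nb X u"] parts_finite[OF assms(1)] by (metis finite_Un)
qed

lemma non_nb_self: "u \<in> X \<Longrightarrow> u \<in> non_nb X u"
  by (simp add: non_nb_def irrefl)

lemma non_nb_pos: "parts X Y \<Longrightarrow> u \<in> X \<Longrightarrow> card (non_nb X u) \<ge> 1"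
  using non_nb_self[of u X] parts_finite[of X Y] unfolding non_nb_def
  by (auto simp: Suc_le_eq card_gt_0_iff)

text \<open>Adjacent vertices lie in different, hence disjoint, twin classes, and every vertex of
  \<open>X\<close> outside both classes is a common neighbour.\<close>

lemma codeg_non_nb:
  assumes "parts X Y" "twins X" "u \<in> X" "v \<in> X" "B u v"
  shows "codeg u v + card (non_nb X u) + card (non_nb X v) = card X"
proof -
  have disj: "non_nb X u \<inter> non_nb X v = {}"
  proof (rule ccontr)
    assume "non_nb X u \<inter> non_nb X v \<noteq> {}"
    then obtain z where "z \<in> X" "\<not> B u z" "\<not> B v z" by (auto simp: non_nb_def)
    then have "nb u = nb z" "nb v = nb z" using assms unfolding twins_def by blast+
    then show False using assms irrefl by (auto simp: nb_def)
  qed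
  have "X = (nb u \<inter> nb v) \<union> (non_nb X u \<union> non_nb X v)" "(nb u \<inter> nb v) \<inter> (non_nb X u \<union> non_nb X v) = {}"
    using parts_nb[OF assms(1,3)] parts_nb[OF assms(1,4)] by (auto simp: nb_def non_nb_def)
  moreover have "finite (non_nb X u)" "finite (non_nb X v)"
    using parts_finite[OF assms(1)] by (auto simp: non_nb_def)
  ultimately have "card X = card (nb u \<inter> nb v) + card (non_nb X u \<union> non_nb X v)"
    using card_Un_disjoint[of "nb u \<inter> nb v" "non_nb X u \<union> non_nb X v"] by simp
  then show ?thesis using disj \<open>finite (non_nb X u)\<close> \<open>finite (non_nb X v)\<close>
    by (simp add: codeg_def card_Un_disjoint)
qed

end

section \<open>Twin classes and their sizes on the two sides of a disconnection\<close>

context rank_two_relation begin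

text \<open>The minor on \<open>u\<close>, \<open>v\<close>, \<open>w\<close> forces both degrees to
  equal the codegree, hence equal neighbourhoods. The exception with an isolated \<open>w\<close> is
  genuine for this minor and shapes \<open>twin_parts_exist\<close>.\<close>

lemma nonadjacent_twins:
  assumes P: "parts X Y" and uv: "u \<in> X" "v \<in> X" "\<not> B u v" and w: "w \<in> Y"
  shows "nb u = nb v \<or> deg w = 0 \<and> (deg u = 0 \<or> deg v = 0)"
proof (cases "u = v")
  case False
  define k x y \<beta> :: real where "k = real (codeg u v)" and "x = deg u - k" and "y = deg v - k"
    and "\<beta> = real (deg w)"
  \<comment> \<open>Of the 5, the order-plus-two normalization accounts for 2 and the vertices
    \<open>u\<close>, \<open>v\<close>, \<open>w\<close> themselves for 3; the rest bounds the union
    of their neighbourhoods.\<close>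
  define \<rho> :: real where "\<rho> = real (card V) + 2 - (k + x + y + \<beta> + 5)"
  have fin: "finite X" "finite Y" using parts_finite[OF P] by auto
  have "insert u (insert v (nb u \<union> nb v)) \<subseteq> X"
    using parts_nb[OF P] uv by blast
  then have "card (insert u (insert v (nb u \<union> nb v))) \<le> card X" using fin card_mono by blast
  moreover have "card (insert u (insert v (nb u \<union> nb v))) = card (nb u \<union> nb v) + 2"
  proof -
    have "u \<notin> nb u \<union> nb v" "v \<notin> nb u \<union> nb v"
      using uv irrefl sym[of u v] by (auto simp: nb_def)
    then show ?thesis using False by simp
  qed
  moreover have "card (nb u \<union> nb v) + codeg u v = deg u + deg v"
    unfolding codeg_def deg_def by (simp add: card_Un_Int[symmetric])
  moreover have "insert w (nb w) \<subseteq> Y" using parts_nb[of Y X w] P w parts_sym[of X Y] by simp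
  then have "card (insert w (nb w)) \<le> card Y" using fin card_mono by blast
  then have "deg w + 1 \<le> card Y" 
  proof -
    have "w \<notin> nb w" using irrefl by (simp add: nb_def)
    then show ?thesis using \<open>card (insert w (nb w)) \<le> card Y\<close> by (simp add: deg_def)
  qed
  ultimately have "deg u + deg v + deg w + 3 \<le> card V + codeg u v"
    using parts_card[OF P] by linarith
  then have "real (deg u + deg v + deg w + 3) \<le> real (card V + codeg u v)" by (rule of_nat_mono)
  then have \<rho>: "\<rho> \<ge> 0" unfolding \<rho>_def x_def y_def \<beta>_def k_def by simp
  have nn: "x \<ge> 0" "y \<ge> 0" "k \<ge> 0" "\<beta> \<ge> 0"
    using codeg_le[of u v] by (auto simp: x_def y_def k_def \<beta>_def)
  have in_V: "u \<in> V" "v \<in> V" "w \<in> V" using P uv w unfolding parts_def by auto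
  have m: "real (card V) + 2 = k + x + y + \<beta> + 5 + \<rho>" by (simp add: \<rho>_def)
  have d: "real (deg u) = k + x" "real (deg v) = k + y" by (simp_all add: x_def y_def)
  have "((k + x + y + \<beta> + 5 + \<rho>) + 15 * \<beta>) * ((k + x) * (k + y) - k\<^sup>2)
    = ((k + x) + (k + y) - 2 * k) * ((k + x) * (k + y) + \<beta> * ((k + x) + (k + y)) + 6 * \<beta> * k
      + \<beta>\<^sup>2 - (k + x + y + \<beta> + 5 + \<rho>) * \<beta>)"
    using gram_det_no_common[OF in_V] parts_no_common[OF P _ w] uv
    by (simp add: m d k_def[symmetric] \<beta>_def[symmetric])
  then have "x = 0 \<and> y = 0 \<or> \<beta> = 0 \<and> k = 0 \<and> (x = 0 \<or> y = 0)"
    by (rule nonadjacent_arith[OF nn \<rho>])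
  then consider "deg u = codeg u v" "deg v = codeg u v" | "deg w = 0" "deg u = 0 \<or> deg v = 0"
    by (auto simp: x_def y_def k_def \<beta>_def)
  then show ?thesis
  proof cases
    case 1
    then have "nb u \<inter> nb v = nb u" "nb u \<inter> nb v = nb v"
      unfolding deg_def codeg_def by (metis card_subset_eq finite_nb inf_le1 inf_le2)+
    then show ?thesis by blast
  qed auto
qed simp

text \<open>If there are isolated vertices, all of them form \<open>Y\<close>; the exception in
  \<open>nonadjacent_twins\<close> then cannot hit \<open>X\<close>, where degrees are positive, and
  isolated vertices are trivially twins. If there are none, the exception never applies and any
  disconnection will do.\<close>

lemma twin_parts_exist:
  assumes "splits V B" and "B x0 y0"
  obtains X Y where "parts X Y" "\<forall>u\<in>X. deg u > 0" "twins X" "twins Y"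
    "(\<forall>u\<in>Y. deg u = 0) \<or> (\<forall>u\<in>Y. deg u > 0)"
proof (cases "\<exists>w\<in>V. deg w = 0")
  case True
  then obtain w where w: "w \<in> V" "deg w = 0" by blast
  let ?Y = "{w \<in> V. deg w = 0}" and ?X = "{w \<in> V. deg w > 0}"
  have "deg x0 \<noteq> 0" using assms(2) by (auto simp: deg_0_iff nb_def)
  then have "x0 \<in> ?X" "x0 \<noteq> w" using in_V[OF assms(2)] w by auto
  moreover have "\<not> B x y" if "deg y = 0" for x y
    using that sym by (auto simp: deg_0_iff nb_def)
  ultimately have P: "parts ?X ?Y" and P': "parts (V - {w}) {w}"
    using w in_V unfolding parts_def by auto
  have "twins ?X"
    unfolding twins_def using nonadjacent_twins[OF P', of _ _ w] w by fastforce
  moreover have "twins ?Y" unfolding twins_def by (auto simp: deg_0_iff)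
  ultimately show ?thesis using that[OF P] by simp
next
  case False
  obtain X Y where P: "parts X Y" using assms(1) unfolding splits_def parts_def by blast
  have "\<forall>u\<in>X \<union> Y. deg u \<noteq> 0" 
  proof
    fix u assume "u \<in> X \<union> Y"
    moreover have "X \<union> Y = V" using P by (simp add: parts_def)
    ultimately have "u \<in> V" by simp
    then show "deg u \<noteq> 0" using False by auto
  qed
  then have pos: "\<forall>u\<in>X. deg u > 0" "\<forall>u\<in>Y. deg u > 0" by auto
  have tw: "twins X" if "parts X Y" "\<forall>u\<in>X. deg u > 0" "\<forall>u\<in>Y. deg u > 0" for X Y
  proof -
    obtain w where "w \<in> Y" using \<open>parts X Y\<close> unfolding parts_def by blast
    then show ?thesis
      unfolding twins_def using nonadjacent_twins[OF \<open>parts X Y\<close>, of _ _ w] that by fastforce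
  qed
  have "parts Y X" using P parts_sym[of X Y] by simp
  show ?thesis using that[OF P pos(1) tw[OF P pos] tw[OF \<open>parts Y X\<close> pos(2,1)]] pos(2) by simp
qed

text \<open>This is \<open>gram_det_no_common\<close> for an edge \<open>u v\<close>, rewritten in
  class sizes; \<open>R\<close> is its parameter \<open>k\<close>, the codegree plus 2 for the edge.
  The shift by 2 in \<open>a\<close> and \<open>b\<close> makes classes of size two the trivial
  solution.\<close>

lemma part_size_identity:
  assumes P: "parts X Y" and tw: "twins X" and uv: "u \<in> X" "v \<in> X" "B u v" and w: "w \<in> Y"
  defines "a \<equiv> int (card (non_nb X u)) - 2" and "b \<equiv> int (card (non_nb X v)) - 2"
    and "R \<equiv> int (codeg u v) + 2" and "\<tau> \<equiv> int (card (non_nb Y w))" and "\<beta> \<equiv> int (deg w)"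
  shows "(a + b) * ((4 + \<tau>) * (R + \<beta>) + 9 * \<beta> * R) + a * b * (R + 4 + \<tau> + 16 * \<beta>) = 0"
proof -
  have in_V: "u \<in> V" "v \<in> V" "w \<in> V" using P uv w unfolding parts_def by auto
  note d = deg_non_nb[OF P uv(1)] deg_non_nb[OF P uv(2)] deg_non_nb[OF P[unfolded parts_sym[of X]] w]
    codeg_non_nb[OF P tw uv]
  \<comment> \<open>The neighbours of \<open>u\<close> are the common neighbours together with the
    class of \<open>v\<close>, so its degree is \<open>R + b\<close>, and symmetrically
    \<open>R + a\<close> for \<open>v\<close>.\<close>
  define U V' m where "U = R + b" and "V' = R + a" and "m = R + a + b + 4 + \<beta> + \<tau>"
  have e: "int (deg u) = U" "int (deg v) = V'" "int (card V) + 2 = m"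
    using d parts_card[OF P] by (simp_all add: U_def V'_def m_def R_def a_def b_def \<tau>_def \<beta>_def)
  have "real_of_int ((m + 15 * \<beta>) * (U * V' - R\<^sup>2))
    = real_of_int ((U + V' - 2 * R) * (U * V' + \<beta> * (U + V') + 6 * \<beta> * R + \<beta>\<^sup>2 - m * \<beta>))"
    using gram_det_no_common[OF in_V] parts_no_common[OF P _ w] uv
    by (simp add: e[symmetric] R_def \<beta>_def)
  then have "(m + 15 * \<beta>) * (U * V' - R\<^sup>2)
    = (U + V' - 2 * R) * (U * V' + \<beta> * (U + V') + 6 * \<beta> * R + \<beta>\<^sup>2 - m * \<beta>)"
    by (simp only: of_int_eq_iff)
  then show ?thesis unfolding U_def V'_def m_def by Groebner_Basis.algebra
qed

text \<open>By \<open>adjacent_arith\<close> the classes of two adjacent vertices both have size 2,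
  or one is a singleton and the other has size at least 3. One vertex violating the first
  alternative already forces all of \<open>X\<close> to be a star, whose size is then governed by
  \<open>star_arith\<close>.\<close>

lemma part_structure:
  assumes P: "parts X Y" and tw: "twins X" and pos: "\<forall>u\<in>X. deg u > 0"
  shows "(\<forall>u\<in>X. card (non_nb X u) = 2) \<or>
    (star B X \<and> (\<exists>a\<in>X. card (non_nb X a) = 1) \<and>
     (\<forall>w\<in>Y. card X = 6 \<and> card (non_nb Y w) = 2 \<or>
       card X = 5 \<and> int (deg w) * (int (card (non_nb Y w)) - 10) = 4))"
proof (rule disjCI)
  let ?t = "\<lambda>u. int (card (non_nb X u)) - 2"
  have P': "parts Y X" using P parts_sym[of X Y] by simp
  obtain w0 where w0: "w0 \<in> Y" using P unfolding parts_def by blast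
  have dich: "?t u = 0 \<and> ?t v = 0 \<or> ?t u = -1 \<and> ?t v \<ge> 1 \<or> ?t u \<ge> 1 \<and> ?t v = -1"
    if "u \<in> X" "v \<in> X" "B u v" for u v
    using adjacent_arith[OF _ _ _ _ _ part_size_identity[OF P tw that w0]]
      non_nb_pos[OF P] non_nb_pos[OF P' w0] that by simp
  assume "\<not> (star B X \<and> (\<exists>a\<in>X. card (non_nb X a) = 1) \<and>
     (\<forall>w\<in>Y. card X = 6 \<and> card (non_nb Y w) = 2 \<or>
       card X = 5 \<and> int (deg w) * (int (card (non_nb Y w)) - 10) = 4))"
  moreover have "star B X \<and> (\<exists>a\<in>X. card (non_nb X a) = 1) \<and>
     (\<forall>w\<in>Y. card X = 6 \<and> card (non_nb Y w) = 2 \<or>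
       card X = 5 \<and> int (deg w) * (int (card (non_nb Y w)) - 10) = 4)"
    if u: "u \<in> X" "card (non_nb X u) \<noteq> 2" for u
  proof -
    obtain v where v: "B u v" "v \<in> X"
      using pos u parts_nb[OF P u(1)] by (fastforce simp: deg_def nb_def card_gt_0_iff)
    have "?t u \<noteq> 0" using u by simp
    then obtain a b where ab: "a \<in> X" "b \<in> X" "B a b" "?t a = -1" "?t b \<ge> 1"
      using dich[OF u(1) v(2,1)] u v sym[of u v] by blast
    have "card (non_nb X a) = 1" using ab by simp
    then have na: "non_nb X a = {a}" using non_nb_self[OF ab(1)] by (metis card_1_singletonE singletonD)
    then have Ba: "B a z" if "z \<in> X" "z \<noteq> a" for z using that by (auto simp: non_nb_def)
    \<comment> \<open>A neighbour \<open>z\<close> of \<open>b\<close> would have a singleton class,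
      since the class of \<open>b\<close> is large. As \<open>z\<close> is also adjacent to
      \<open>a\<close>, two adjacent singleton classes would result, contrary to
      \<open>dich\<close>.\<close>
    have Bb: "\<not> B b z" if "z \<in> X" "z \<noteq> a" for z
    proof
      assume "B b z"
      then have "?t z = -1" using dich[OF ab(2) that(1)] ab(5) by auto
      then show False using dich[OF ab(1) that(1) Ba[OF that]] ab(4) by auto
    qed
    have nbb: "nb z = nb b" if "z \<in> X" "z \<noteq> a" for z
      using tw Bb[OF that] that ab unfolding twins_def by blast
    have nb: "B z y \<longleftrightarrow> y = a" if "z \<in> X" "z \<noteq> a" "y \<in> X" for z y
    proof -
      have "B z y \<longleftrightarrow> B b y" using nbb[OF that(1,2)] unfolding nb_def by (metis mem_Collect_eq)
      moreover have "B b a" using ab(3) sym[of a b] by simp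
      ultimately show ?thesis using Bb[OF that(3)] by blast
    qed
    have Baa: "B x y \<longleftrightarrow> (x = a) \<noteq> (y = a)" if "x \<in> X" "y \<in> X" for x y
      using nb[of x y] Ba[of y] irrefl[of a] that by (cases "x = a") auto
    then have star: "star B X" using ab(1) unfolding star_def by blast
    have nnz: "non_nb X z = X - {a}" if "z \<in> X" "z \<noteq> a" for z
      using Baa that by (auto simp: non_nb_def)
    have cX: "card X \<ge> 1" "card (X - {a}) = card X - 1" "b \<noteq> a"
      using ab(1) ab(3) irrefl parts_finite[OF P] by (auto simp: Suc_le_eq card_gt_0_iff)
    then have tb: "?t b = int (card X) - 3" using nnz[OF ab(2)] by simp
    \<comment> \<open>Centre and leaf have no common neighbour, which puts \<open>R = 2\<close> and
      leads to \<open>star_arith\<close>.\<close>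
    have cd: "codeg a b = 0"
      using codeg_non_nb[OF P tw ab(1-3)] na nnz[OF ab(2)] cX by simp
    have sizes: "card X = 6 \<and> card (non_nb Y w) = 2 \<or>
       card X = 5 \<and> int (deg w) * (int (card (non_nb Y w)) - 10) = 4" if w: "w \<in> Y" for w
    proof -
      have "?t b = 3 \<and> int (card (non_nb Y w)) = 2 \<or> ?t b = 2 \<and> int (deg w) * (int (card (non_nb Y w)) - 10) = 4"
        using part_size_identity[OF P tw ab(1-3) w] ab(4,5) cd non_nb_pos[OF P' w]
        by (intro star_arith) (simp_all add: algebra_simps)
      then show ?thesis using tb by auto
    qed
    show ?thesis using star sizes ab(1) \<open>card (non_nb X a) = 1\<close> by blast
  qed
  ultimately show "\<forall>u\<in>X. card (non_nb X u) = 2" by blast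
qed

lemma cocktailI:
  assumes P: "parts X Y" and "\<forall>u\<in>X. card (non_nb X u) = 2"
  shows "cocktail B X"
  unfolding cocktail_def
proof
  fix u assume u: "u \<in> X"
  then have "card (non_nb X u) = 2" using assms by blast
  then obtain x y where "non_nb X u = {x, y}" "x \<noteq> y" by (auto simp: card_2_iff)
  then obtain u' where u': "u' \<noteq> u" "non_nb X u = {u, u'}"
    using non_nb_self[OF u] by (metis doubleton_eq_iff insertE singletonD)
  then have "u' \<in> X" by (auto simp: non_nb_def)
  moreover have "B u z \<longleftrightarrow> z \<noteq> u \<and> z \<noteq> u'" if "z \<in> X" for z
    using u'(2) that unfolding non_nb_def by blast
  ultimately show "\<exists>u'\<in>X. u' \<noteq> u \<and> (\<forall>z\<in>X. B u z \<longleftrightarrow> z \<noteq> u \<and> z \<noteq> u')" using u' by blast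
qed

text \<open>Beyond \<open>part_structure\<close> on both sides, only the alternative of a star on
  five vertices must be refuted. Its equation fails because the left side is 0 or a multiple of 8 or
  9, according to the shape of the other side.\<close>

theorem relation_structure:
  assumes "splits V B" and "B x0 y0"
  shows "\<exists>X Y. parts X Y \<and>
    (cocktail B X \<and> card X \<ge> 3 \<and> edgeless B Y \<or>
     cocktail B X \<and> card X \<ge> 3 \<and> cocktail B Y \<and> card Y \<ge> 3 \<or>
     star B X \<and> card X = 6 \<and> cocktail B Y)"
proof -
  obtain X Y where P: "parts X Y" and posX: "\<forall>u\<in>X. deg u > 0" and tX: "twins X" and tY: "twins Y"
    and Y: "(\<forall>u\<in>Y. deg u = 0) \<or> (\<forall>u\<in>Y. deg u > 0)"
    using twin_parts_exist[OF assms] by blast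
  have P': "parts Y X" using P parts_sym[of X Y] by simp
  obtain x where x: "x \<in> X" using P unfolding parts_def by blast
  obtain y where y: "y \<in> Y" using P unfolding parts_def by blast
  let ?two = "\<lambda>X. \<forall>u\<in>X. card (non_nb X u) = 2"
  have two: "cocktail B X \<and> card X \<ge> 3" if P: "parts X Y" and two: "?two X" and pos: "\<forall>u\<in>X. deg u > 0" for X Y
  proof -
    obtain x where x: "x \<in> X" using P unfolding parts_def by blast
    then have "deg x > 0" "card (non_nb X x) = 2" using two pos by blast+
    then show ?thesis using deg_non_nb[OF P x] cocktailI[OF P two] by linarith
  qed
  note X = part_structure[OF P tX posX]
  show ?thesis
  proof (cases "\<forall>u\<in>Y. deg u = 0")
    case True
    then have el: "edgeless B Y" by (auto simp: edgeless_def deg_0_iff nb_def)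
    show ?thesis
    proof (cases "?two X")
      case True
      then show ?thesis using el two[OF P True posX] P by blast
    next
      case False
      then have s: "star B X" and sz: "\<forall>w\<in>Y. card X = 6 \<and> card (non_nb Y w) = 2 \<or>
       card X = 5 \<and> int (deg w) * (int (card (non_nb Y w)) - 10) = 4" using X by blast+
      \<comment> \<open>Degree zero makes the product 0 instead of 4. What survives is K_{1,5} with
        two isolated vertices, and such a pair is the smallest nonempty cocktail party graph; hence
        no lower bound on \<open>card Y\<close> in the star case.\<close>
      have "\<forall>w\<in>Y. card X = 6 \<and> card (non_nb Y w) = 2" using sz True by auto
      then have "card X = 6" "?two Y" using y by blast+
      then show ?thesis using s cocktailI[OF P'] P by blast
    qed
  next
    case False
    then have posY: "\<forall>u\<in>Y. deg u > 0" using Y by blast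
    note Y = part_structure[OF P' tY posY]
    have star_case: "star B X \<and> card X = 6 \<and> cocktail B Y"
      if P: "parts X Y" and s: "star B X" and sz: "\<forall>w\<in>Y. card X = 6 \<and> card (non_nb Y w) = 2 \<or>
       card X = 5 \<and> int (deg w) * (int (card (non_nb Y w)) - 10) = 4" and two: "?two Y" for X Y
    proof -
      obtain y where y: "y \<in> Y" using P unfolding parts_def by blast
      \<comment> \<open>The second factor is 2 - 10 = -8.\<close>
      have "int (deg y) * (int (card (non_nb Y y)) - 10) \<noteq> 4" using two y by simp
      then have "card X = 6" using sz y by blast
      moreover have "parts Y X" using P parts_sym[of X Y] by simp
      ultimately show ?thesis using s cocktailI[OF _ two] by simp
    qed
    consider "?two X" "?two Y" | "?two X" "\<not> ?two Y" | "\<not> ?two X" "?two Y" | "\<not> ?two X" "\<not> ?two Y"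
      by blast
    then show ?thesis
    proof cases
      case 1
      then show ?thesis using two[OF P _ posX] two[OF P' _ posY] P by blast
    next
      case 2
      then show ?thesis using star_case[OF P'] Y P' by blast
    next
      case 3
      then show ?thesis using star_case[OF P] X P by blast
    next
      case 4
      \<comment> \<open>Two stars: at the centre \<open>w\<close> of the second one the class size
        is 1, so the first alternative fails and the product is a multiple of 9.\<close>
      have "\<exists>w\<in>Y. card (non_nb Y w) = 1" using Y 4(2) by blast
      then obtain w where w: "w \<in> Y" "card (non_nb Y w) = 1" by blast
      have "card X = 6 \<and> card (non_nb Y w) = 2 \<or>
       card X = 5 \<and> int (deg w) * (int (card (non_nb Y w)) - 10) = 4" using X 4(1) w(1) by blast
      then show ?thesis using w(2) by simp
    qed
  qed
qed

end

section \<open>Isomorphisms and invariants\<close>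

definition rel_iso :: "('a \<Rightarrow> 'a \<Rightarrow> bool) \<Rightarrow> 'a set \<Rightarrow> ('b \<Rightarrow> 'b \<Rightarrow> bool) \<Rightarrow> 'b set \<Rightarrow> bool" where
  "rel_iso B S B' S' \<longleftrightarrow> (\<exists>f. bij_betw f S S' \<and> (\<forall>x\<in>S. \<forall>y\<in>S. B x y \<longleftrightarrow> B' (f x) (f y)))"

lemma rel_iso_edgeless:
  assumes "finite S" "finite S'" "card S = card S'" "edgeless B S" "edgeless B' S'"
  shows "rel_iso B S B' S'"
proof -
  obtain f where "bij_betw f S S'" using assms finite_same_card_bij by blast
  moreover have "f x \<in> S'" if "x \<in> S" for x using bij_betwE[OF calculation] that by blast
  ultimately show ?thesis using assms(4,5) unfolding rel_iso_def edgeless_def by blast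
qed

lemma rel_iso_star:
  assumes "finite S" "finite S'" "card S = card S'" "star B S" "star B' S'"
  shows "rel_iso B S B' S'"
proof -
  obtain a where a: "a \<in> S" "\<And>u v. u \<in> S \<Longrightarrow> v \<in> S \<Longrightarrow> B u v \<longleftrightarrow> (u = a) \<noteq> (v = a)"
    using assms(4) unfolding star_def by blast
  obtain a' where a': "a' \<in> S'" "\<And>u v. u \<in> S' \<Longrightarrow> v \<in> S' \<Longrightarrow> B' u v \<longleftrightarrow> (u = a') \<noteq> (v = a')"
    using assms(5) unfolding star_def by blast
  have "card (S - {a}) = card (S' - {a'})" using a(1) a'(1) assms(3) by simp
  then obtain f where f: "bij_betw f (S - {a}) (S' - {a'})"
    using assms finite_same_card_bij by blast
  define g where "g = f(a := a')"
  have "bij_betw g (S - {a}) (S' - {a'})"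
    using f by (rule bij_betw_cong[THEN iffD1, rotated]) (simp add: g_def)
  then have "bij_betw g (insert a (S - {a})) (insert (g a) (S' - {a'}))"
    by (intro notIn_Un_bij_betw[where b = a, simplified]) (auto simp: g_def)
  then have bij: "bij_betw g S S'" using a(1) a'(1) by (simp add: g_def insert_absorb)
  have ga: "g x = a' \<longleftrightarrow> x = a" if "x \<in> S" for x
    using bij_betw_imp_inj_on[OF bij] a(1) that by (metis fun_upd_same g_def inj_onD)
  have "B x y \<longleftrightarrow> B' (g x) (g y)" if "x \<in> S" "y \<in> S" for x y
    using a(2)[OF that] a'(2)[of "g x" "g y"] bij_betwE[OF bij] ga that by simp
  then show ?thesis using bij unfolding rel_iso_def by blast
qed

text \<open>The unique non-neighbour relation is mutual, so any other vertex is adjacent to both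
  members of the pair and keeps its own partner after their removal. This drives the inductions that
  peel off pairs.\<close>

lemma cocktail_remove:
  assumes sym: "\<And>x y. B x y \<longleftrightarrow> B y x" and S: "cocktail B S"
    and u: "u \<in> S" "u' \<in> S" "u' \<noteq> u" "\<forall>z\<in>S. B u z \<longleftrightarrow> z \<noteq> u \<and> z \<noteq> u'"
  shows "cocktail B (S - {u, u'})" "\<forall>z\<in>S. B u' z \<longleftrightarrow> z \<noteq> u \<and> z \<noteq> u'"
proof -
  show u': "\<forall>z\<in>S. B u' z \<longleftrightarrow> z \<noteq> u \<and> z \<noteq> u'"
  proof -
    obtain v where v: "v \<in> S" "v \<noteq> u'" "\<forall>z\<in>S. B u' z \<longleftrightarrow> z \<noteq> u' \<and> z \<noteq> v"
      using S u(2) unfolding cocktail_def by blast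
    have "\<not> B u u'" using u by blast
    then have "\<not> B u' u" using sym[of u u'] by simp
    then have "v = u" using v(3) u(1,3) by blast
    then show ?thesis using v(3) by blast
  qed
  show "cocktail B (S - {u, u'})"
    unfolding cocktail_def
  proof
    fix x assume x: "x \<in> S - {u, u'}"
    then obtain y where y: "y \<in> S" "y \<noteq> x" "\<forall>z\<in>S. B x z \<longleftrightarrow> z \<noteq> x \<and> z \<noteq> y"
      using S unfolding cocktail_def by blast
    have "B u x" "B u' x" using u u' x by blast+
    then have "B x u" "B x u'" using sym[of x] by blast+
    then have "y \<noteq> u" "y \<noteq> u'" using y(3) u(1,2) by blast+
    then show "\<exists>y\<in>S - {u, u'}. y \<noteq> x \<and> (\<forall>z\<in>S - {u, u'}. B x z \<longleftrightarrow> z \<noteq> x \<and> z \<noteq> y)"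
      using y by blast
  qed
qed

text \<open>The vertices fall into nonadjacent pairs. Parity is needed for the divisibility by 8
  that tells cocktail party graphs from the star.\<close>

lemma cocktail_even:
  assumes sym: "\<And>x y. B x y \<longleftrightarrow> B y x" and "finite S" "cocktail B S"
  shows "even (card S)"
  using assms(2,3)
proof (induction "card S" arbitrary: S rule: less_induct)
  case less
  show ?case
  proof (cases "S = {}")
    case False
    then obtain u where "u \<in> S" by blast
    then obtain u' where u: "u \<in> S" "u' \<in> S" "u' \<noteq> u" "\<forall>z\<in>S. B u z \<longleftrightarrow> z \<noteq> u \<and> z \<noteq> u'"
      using less.prems(2) unfolding cocktail_def by blast
    have "card {u, u'} \<le> card S" using u less.prems by (intro card_mono) auto
    moreover have "card (S - {u, u'}) = card S - 2"
      using u by (subst card_Diff_subset) auto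
    moreover have "cocktail B (S - {u, u'})" by (rule cocktail_remove[OF sym less.prems(2) u])
    ultimately show ?thesis using less.hyps[of "S - {u, u'}"] less.prems u by auto
  qed simp
qed

lemma rel_iso_cocktail:
  assumes sym: "\<And>x y. B x y \<longleftrightarrow> B y x" and sym': "\<And>x y. B' x y \<longleftrightarrow> B' y x"
    and "finite S" "finite S'" "card S = card S'" "cocktail B S" "cocktail B' S'"
  shows "rel_iso B S B' S'"
  using assms(3-)
proof (induction "card S" arbitrary: S S' rule: less_induct)
  case less
  show ?case
  proof (cases "S = {}")
    case True
    then have "S' = {}" using less.prems by simp
    then show ?thesis using True unfolding rel_iso_def by (auto simp: bij_betw_def)
  next
    case False
    then obtain u where "u \<in> S" by blast
    then obtain u' where u: "u \<in> S" "u' \<in> S" "u' \<noteq> u" "\<forall>z\<in>S. B u z \<longleftrightarrow> z \<noteq> u \<and> z \<noteq> u'"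
      using less.prems(4) unfolding cocktail_def by blast
    have "S' \<noteq> {}" using False less.prems by auto
    then obtain v where "v \<in> S'" by blast
    then obtain v' where v: "v \<in> S'" "v' \<in> S'" "v' \<noteq> v" "\<forall>z\<in>S'. B' v z \<longleftrightarrow> z \<noteq> v \<and> z \<noteq> v'"
      using less.prems(5) unfolding cocktail_def by blast
    let ?S = "S - {u, u'}" and ?T = "S' - {v, v'}"
    have c: "card ?S = card S - 2" "card ?T = card S' - 2"
      using u v by (subst card_Diff_subset; auto)+
    have "card S > 0" using False less.prems(1) by (simp add: card_gt_0_iff)
    have "rel_iso B ?S B' ?T"
      using less.prems c \<open>card S > 0\<close> cocktail_remove(1)[OF sym less.prems(4) u]
        cocktail_remove(1)[OF sym' less.prems(5) v]
      by (intro less.hyps) auto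
    then obtain f where f: "bij_betw f ?S ?T" "\<forall>x\<in>?S. \<forall>y\<in>?S. B x y \<longleftrightarrow> B' (f x) (f y)"
      unfolding rel_iso_def by blast
    define g where "g = f(u := v, u' := v')"
    have g: "g u = v" "g u' = v'" "\<And>x. x \<in> ?S \<Longrightarrow> g x = f x" using u by (auto simp: g_def)
    have g': "g x \<in> ?T" if "x \<in> ?S" for x using g(3)[OF that] bij_betwE[OF f(1)] that by simp
    have "bij_betw g ?S ?T" using f(1) by (rule bij_betw_cong[THEN iffD1, rotated]) (simp add: g)
    moreover have "bij_betw g {u, u'} {v, v'}" using u v g by (auto simp: bij_betw_def)
    ultimately have "bij_betw g (?S \<union> {u, u'}) (?T \<union> {v, v'})"
      by (rule bij_betw_combine) auto
    moreover have "?S \<union> {u, u'} = S" "?T \<union> {v, v'} = S'" using u v by auto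
    ultimately have bij: "bij_betw g S S'" by simp
    have gin: "g x \<in> S'" if "x \<in> S" for x using bij_betwE[OF bij] that by blast
    have inj: "g x = g y \<longleftrightarrow> x = y" if "x \<in> S" "y \<in> S" for x y
      using bij_betw_imp_inj_on[OF bij] that by (metis inj_onD)
    note u2 = cocktail_remove(2)[OF sym less.prems(4) u]
      and v2 = cocktail_remove(2)[OF sym' less.prems(5) v]
    have rows: "B x y \<longleftrightarrow> B' (g x) (g y)" if x: "x \<in> {u, u'}" and y: "y \<in> S" for x y
    proof -
      have "B x y \<longleftrightarrow> y \<noteq> u \<and> y \<noteq> u'" using u(4) u2 x y by blast
      moreover have "B' (g x) (g y) \<longleftrightarrow> g y \<noteq> v \<and> g y \<noteq> v'"
        using v(4) v2 x gin[OF y] g(1,2) by (metis insertE singletonD)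
      moreover have "g y = v \<longleftrightarrow> y = u" "g y = v' \<longleftrightarrow> y = u'"
        using inj[OF y u(1)] inj[OF y u(2)] g(1,2) by simp_all
      ultimately show ?thesis by simp
    qed
    have "B x y \<longleftrightarrow> B' (g x) (g y)" if x: "x \<in> S" and y: "y \<in> S" for x y
    proof -
      consider "x \<in> {u, u'}" | "y \<in> {u, u'}" | "x \<in> ?S" "y \<in> ?S" using x y by blast
      then show ?thesis
      proof cases
        case 1
        then show ?thesis using y by (rule rows)
      next
        case 2
        then show ?thesis using rows[OF 2 x] sym[of x y] sym'[of "g x" "g y"] by simp
      next
        case 3
        then show ?thesis using f(2) g(3) by simp
      qed
    qed
    then show ?thesis using bij unfolding rel_iso_def by blast
  qed
qed

lemma rel_iso_Un:
  assumes "rel_iso B X B' X'" "rel_iso B Y B' Y'"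
    and "X \<inter> Y = {}" "X' \<inter> Y' = {}"
    and no: "\<And>x y. x \<in> X \<Longrightarrow> y \<in> Y \<Longrightarrow> \<not> B x y \<and> \<not> B y x" "\<And>x y. x \<in> X' \<Longrightarrow> y \<in> Y' \<Longrightarrow> \<not> B' x y \<and> \<not> B' y x"
  shows "rel_iso B (X \<union> Y) B' (X' \<union> Y')"
proof -
  obtain f g where f: "bij_betw f X X'" "\<And>x y. x \<in> X \<Longrightarrow> y \<in> X \<Longrightarrow> B x y \<longleftrightarrow> B' (f x) (f y)"
    and g: "bij_betw g Y Y'" "\<And>x y. x \<in> Y \<Longrightarrow> y \<in> Y \<Longrightarrow> B x y \<longleftrightarrow> B' (g x) (g y)"
    using assms(1,2) unfolding rel_iso_def by blast
  define h where "h = (\<lambda>x. if x \<in> X then f x else g x)"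
  have hX: "h x = f x" "h x \<in> X'" if "x \<in> X" for x
    using that bij_betwE[OF f(1)] by (auto simp: h_def)
  have hY: "h y = g y" "h y \<in> Y'" if "y \<in> Y" for y
  proof -
    show "h y = g y" using that assms(3) by (auto simp: h_def)
    then show "h y \<in> Y'" using that bij_betwE[OF g(1)] by simp
  qed
  have "bij_betw h X X'" using f(1) by (rule bij_betw_cong[THEN iffD1, rotated]) (simp add: hX)
  moreover have "bij_betw h Y Y'" using g(1) by (rule bij_betw_cong[THEN iffD1, rotated]) (simp add: hY)
  ultimately have "bij_betw h (X \<union> Y) (X' \<union> Y')" by (rule bij_betw_combine) fact
  moreover have "B x y \<longleftrightarrow> B' (h x) (h y)" if x: "x \<in> X \<union> Y" and y: "y \<in> X \<union> Y" for x y
  proof -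
    consider "x \<in> X" "y \<in> X" | "x \<in> Y" "y \<in> Y" | "x \<in> X" "y \<in> Y" | "x \<in> Y" "y \<in> X" using x y by blast
    then show ?thesis
      by cases (use f(2) g(2) hX hY no in \<open>simp_all\<close>)
  qed
  ultimately show ?thesis unfolding rel_iso_def by blast
qed

section \<open>Degree sums and cubic sums of the possible sides\<close>

context vertex_relation begin

definition deg_sum :: "'a set \<Rightarrow> int" where
  "deg_sum S = (\<Sum>x\<in>S. int (deg x))"

text \<open>Up to terms in the order and the size, this is the trace of $(J + B)^3$.\<close>
definition cubic_sum :: "'a set \<Rightarrow> int" where
  "cubic_sum S = (\<Sum>x\<in>S. 3 * (int (deg x))\<^sup>2 + (\<Sum>y\<in>nb x. int (codeg x y)))"

lemma parts_deg_sum: "parts X Y \<Longrightarrow> deg_sum V = deg_sum X + deg_sum Y"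
  using parts_finite[of X Y] unfolding parts_def deg_sum_def by (metis sum.union_disjoint)

lemma parts_cubic_sum: "parts X Y \<Longrightarrow> cubic_sum V = cubic_sum X + cubic_sum Y"
  using parts_finite[of X Y] unfolding parts_def cubic_sum_def by (metis (no_types, lifting) sum.union_disjoint)

lemma edgeless_sums:
  assumes "parts X Y" "edgeless B Y"
  shows "deg_sum Y = 0" "cubic_sum Y = 0"
proof -
  have "nb y = {}" if "y \<in> Y" for y
    using parts_nb[of Y X y] parts_sym[of X Y] assms that unfolding edgeless_def nb_def by blast
  then show "deg_sum Y = 0" "cubic_sum Y = 0"
    unfolding deg_sum_def cubic_sum_def by (simp_all add: deg_def)
qed

text \<open>The centre contributes 5 and each of the five leaves 1. The residue 2 modulo 8 is what
  identifies the star case later.\<close>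

lemma star_deg_sum:
  assumes P: "parts X Y" and "star B X" "card X = 6"
  shows "deg_sum X = 10"
proof -
  have fin: "finite X" using parts_finite[OF P] by simp
  obtain a where a: "a \<in> X" "\<And>u v. u \<in> X \<Longrightarrow> v \<in> X \<Longrightarrow> B u v \<longleftrightarrow> (u = a) \<noteq> (v = a)"
    using assms(2) unfolding star_def by blast
  have nbX: "nb u = {v \<in> X. B u v}" if "u \<in> X" for u using parts_nb[OF P that] by (auto simp: nb_def)
  have "nb a = X - {a}" unfolding nbX[OF a(1)] using a by auto
  then have da: "deg a = 5" using a(1) assms(3) by (simp add: deg_def)
  have "nb u = {a}" if "u \<in> X - {a}" for u
    using that a by (subst nbX) auto
  then have "deg u = 1" if "u \<in> X - {a}" for u using that by (simp add: deg_def)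
  then have "deg_sum (X - {a}) = 5" using a(1) assms(3) by (simp add: deg_sum_def)
  then show ?thesis using da a(1) fin by (simp add: deg_sum_def sum.remove)
qed

text \<open>A vertex misses itself and its partner; two adjacent vertices lie in different pairs and
  together miss four vertices. Hence degrees are \<open>s - 2\<close>, codegrees of edges
  \<open>s - 4\<close>, and 3(s-2) + (s-4) = 4s - 10.\<close>

lemma cocktail_sums:
  assumes P: "parts X Y" and C: "cocktail B X"
  defines "s \<equiv> int (card X)"
  shows "deg_sum X = s * (s - 2)" "cubic_sum X = s * (s - 2) * (4 * s - 10)"
proof -
  have fin: "finite X" using parts_finite[OF P] by simp
  have deg: "int (deg u) = s - 2 \<and> (\<Sum>y\<in>nb u. int (codeg u y)) = (s - 2) * (s - 4)" if u: "u \<in> X" for u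
  proof -
    obtain u' where u': "u' \<in> X" "u' \<noteq> u" "\<forall>z\<in>X. B u z \<longleftrightarrow> z \<noteq> u \<and> z \<noteq> u'"
      using C u unfolding cocktail_def by blast
    have nbu: "nb u = X - {u, u'}" using parts_nb[OF P u] u' by (auto simp: nb_def)
    have ge: "card {u, u'} \<le> card X" using u u' fin by (intro card_mono) auto
    have "card (X - {u, u'}) = card X - 2" using u u' by (subst card_Diff_subset) auto
    then have d: "int (deg u) = s - 2" using nbu ge u'(2) by (simp add: deg_def s_def)
    have "int (codeg u y) = s - 4" if y: "y \<in> nb u" for y
    proof -
      have yX: "y \<in> X" "y \<noteq> u" "y \<noteq> u'" using y nbu by auto
      obtain y' where y': "y' \<in> X" "y' \<noteq> y" "\<forall>z\<in>X. B y z \<longleftrightarrow> z \<noteq> y \<and> z \<noteq> y'"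
        using C yX(1) unfolding cocktail_def by blast
      have "\<forall>z\<in>X. B u' z \<longleftrightarrow> z \<noteq> u \<and> z \<noteq> u'" by (rule cocktail_remove(2)[OF sym C u u'])
      then have "B y u" "B y u'" using u'(3) yX sym[of y] by blast+
      then have "y' \<noteq> u" "y' \<noteq> u'" using y'(3) u u'(1) by blast+
      then have c4: "card {u, u', y, y'} = 4" using yX u' y' by simp
      have "nb y = X - {y, y'}" using parts_nb[OF P yX(1)] y' by (auto simp: nb_def)
      then have "nb u \<inter> nb y = X - {u, u', y, y'}" using nbu by auto
      moreover have sub: "{u, u', y, y'} \<subseteq> X" using u u' y' yX by auto
      ultimately have "codeg u y = card X - 4"
        unfolding codeg_def using c4 by (simp only: card_Diff_subset finite.intros)
      moreover have "4 \<le> card X" using card_mono[OF fin sub] c4 by simp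
      ultimately show ?thesis by (simp add: s_def)
    qed
    then show ?thesis using d by (simp add: deg_def)
  qed
  show "deg_sum X = s * (s - 2)" unfolding deg_sum_def using deg by (simp add: s_def)
  have "cubic_sum X = (\<Sum>u\<in>X. 3 * (s - 2)\<^sup>2 + (s - 2) * (s - 4))"
    unfolding cubic_sum_def using deg by (intro sum.cong) auto
  then show "cubic_sum X = s * (s - 2) * (4 * s - 10)"
    by (simp add: s_def algebra_simps power2_eq_square)
qed

end

section \<open>Recovering cocktail party sizes from the invariants\<close>

lemma cocktail_size_mono:
  fixes a x :: int
  assumes "a \<ge> 3" "x \<ge> 3" "a * (a - 2) < x * (x - 2)"
  shows "a < x"
proof (rule ccontr)
  assume "\<not> a < x"
  then have "x * (x - 2) \<le> a * (a - 2)" using assms by (intro mult_mono) auto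
  then show False using assms by simp
qed

lemma cocktail_size_unique:
  fixes a x :: int
  assumes "a \<ge> 3" "x \<ge> 3" "a * (a - 2) = x * (x - 2)"
  shows "a = x"
proof -
  have "(a - x) * (a + x - 2) = 0" using assms(3) by (simp add: algebra_simps)
  then show ?thesis using assms by auto
qed

text \<open>The cubic sum weights the degree sum by \<open>4 * s - 10\<close>, which grows with the
  size. One graph having the degree sum of two together is larger than each of them, so its cubic
  sum is strictly larger.\<close>

lemma cocktail_pair_neq:
  fixes a b x :: int
  assumes "a \<ge> 3" "b \<ge> 3" "x \<ge> 3" and e: "x * (x - 2) = a * (a - 2) + b * (b - 2)"
  shows "x * (x - 2) * (4 * x - 10) \<noteq> a * (a - 2) * (4 * a - 10) + b * (b - 2) * (4 * b - 10)"
proof -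
  have pos: "a * (a - 2) > 0" "b * (b - 2) > 0" using assms by auto
  have "a < x" "b < x" using cocktail_size_mono[of a x] cocktail_size_mono[of b x] assms pos by auto
  then have "a * (a - 2) * (4 * a - 10) < a * (a - 2) * (4 * x - 10)"
    "b * (b - 2) * (4 * b - 10) < b * (b - 2) * (4 * x - 10)"
    using pos by (auto intro!: mult_strict_left_mono)
  moreover have "x * (x - 2) * (4 * x - 10) = a * (a - 2) * (4 * x - 10) + b * (b - 2) * (4 * x - 10)"
    unfolding e by (simp add: algebra_simps)
  ultimately show ?thesis by linarith
qed

text \<open>A sum and a sum of squares determine an unordered pair: eliminating \<open>b\<close>
  leaves (a - c)(a - d) = 0.\<close>

lemma cocktail_pair_unique:
  fixes a b c d :: int
  assumes "a + b = c + d" "a * (a - 2) + b * (b - 2) = c * (c - 2) + d * (d - 2)"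
  shows "a = c \<and> b = d \<or> a = d \<and> b = c"
proof -
  have b: "b = c + d - a" using assms(1) by simp
  have "2 * ((a - c) * (a - d)) = 0" using assms(2) unfolding b by (simp add: algebra_simps)
  then show ?thesis using assms(1) by auto
qed

lemma even_size_mod_8: "even (n :: nat) \<Longrightarrow> int n * (int n - 2) mod 8 = 0"
proof -
  assume "even n"
  then obtain k where k: "n = 2 * k" by blast
  \<comment> \<open>One of two consecutive integers is even, which gives the last factor 2 next to
    the 4 of \<open>n = 2 * k\<close>.\<close>
  have "even (int k * (int k - 1))" by simp
  then obtain j where "int k * (int k - 1) = 2 * j" by blast
  then have "int n * (int n - 2) = 8 * j" unfolding k by (simp add: algebra_simps)
  then show ?thesis by simp
qed

text \<open>The degree sum modulo 8 is 2 exactly in the star case. Otherwise the cubic sum tells one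
  cocktail party graph with isolated vertices from two such graphs, and order and degree sum then
  fix the sizes, in the case of two up to exchange of the sides.\<close>

theorem rank_two_relation_iso:
  assumes G: "rank_two_relation V B" "splits V B" "B x0 y0"
    and H: "rank_two_relation V' B'" "splits V' B'" "B' x1 y1"
    and c: "card V = card V'"
    and e: "vertex_relation.deg_sum B V = vertex_relation.deg_sum B' V'"
    and q: "vertex_relation.cubic_sum B V = vertex_relation.cubic_sum B' V'"
  shows "rel_iso B V B' V'"
proof -
  interpret G: rank_two_relation V B by (rule G)
  interpret H: rank_two_relation V' B' by (rule H)
  obtain X Y where P: "G.parts X Y" and
    XY: "cocktail B X \<and> card X \<ge> 3 \<and> edgeless B Y \<or>
     cocktail B X \<and> card X \<ge> 3 \<and> cocktail B Y \<and> card Y \<ge> 3 \<or>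
     star B X \<and> card X = 6 \<and> cocktail B Y" using G.relation_structure[OF G(2,3)] by blast
  obtain X' Y' where P': "H.parts X' Y'" and
    XY': "cocktail B' X' \<and> card X' \<ge> 3 \<and> edgeless B' Y' \<or>
     cocktail B' X' \<and> card X' \<ge> 3 \<and> cocktail B' Y' \<and> card Y' \<ge> 3 \<or>
     star B' X' \<and> card X' = 6 \<and> cocktail B' Y'" using H.relation_structure[OF H(2,3)] by blast
  have Q: "G.parts Y X" and Q': "H.parts Y' X'" using P P' G.parts_sym[of X Y] H.parts_sym[of X' Y'] by simp_all
  note fin = G.parts_finite[OF P] H.parts_finite[OF P']
  have glue: "rel_iso B V B' V'" if "H.parts Z W" "rel_iso B X B' Z" "rel_iso B Y B' W" for Z W
  proof -
    have "X \<union> Y = V" "X \<inter> Y = {}" "Z \<union> W = V'" "Z \<inter> W = {}"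
      using P that(1) unfolding G.parts_def H.parts_def by simp_all
    moreover have "\<not> B x y \<and> \<not> B y x" if "x \<in> X" "y \<in> Y" for x y
      using P that G.sym[of x y] unfolding G.parts_def by simp
    moreover have "\<not> B' x y \<and> \<not> B' y x" if "x \<in> Z" "y \<in> W" for x y
      using \<open>H.parts Z W\<close> that H.sym[of x y] unfolding H.parts_def by simp
    ultimately show ?thesis using rel_iso_Un[OF that(2,3)] by simp
  qed
  note cock = rel_iso_cocktail[OF G.sym H.sym]
  have cs: "card X + card Y = card X' + card Y'"
    using c G.parts_card[OF P] H.parts_card[OF P'] by simp
  have es: "G.deg_sum X + G.deg_sum Y = H.deg_sum X' + H.deg_sum Y'"
    and qs: "G.cubic_sum X + G.cubic_sum Y = H.cubic_sum X' + H.cubic_sum Y'"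
    using e q G.parts_deg_sum[OF P] H.parts_deg_sum[OF P'] G.parts_cubic_sum[OF P] H.parts_cubic_sum[OF P']
    by simp_all
  have mod: "G.deg_sum X mod 8 = 0" if "G.parts X Y" "cocktail B X" for X Y
    using G.cocktail_sums(1)[OF that] even_size_mod_8[OF cocktail_even[OF G.sym _ that(2)]]
      G.parts_finite[OF that(1)] by simp
  have mod': "H.deg_sum X mod 8 = 0" if "H.parts X Y" "cocktail B' X" for X Y
    using H.cocktail_sums(1)[OF that] even_size_mod_8[OF cocktail_even[OF H.sym _ that(2)]]
      H.parts_finite[OF that(1)] by simp
  note gs = G.cocktail_sums[OF P] G.cocktail_sums[OF Q] G.edgeless_sums[OF P] G.star_deg_sum[OF P]
    and hs = H.cocktail_sums[OF P'] H.cocktail_sums[OF Q'] H.edgeless_sums[OF P'] H.star_deg_sum[OF P']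
  show ?thesis
  proof (cases "star B X \<and> card X = 6 \<and> cocktail B Y")
    case g3: True
    then have m: "(G.deg_sum X + G.deg_sum Y) mod 8 = 2"
      using gs mod[OF Q] by presburger
    have h3: "star B' X' \<and> card X' = 6 \<and> cocktail B' Y'"
    proof (rule ccontr)
      assume "\<not> (star B' X' \<and> card X' = 6 \<and> cocktail B' Y')"
      then have "H.deg_sum X' mod 8 = 0" "H.deg_sum Y' mod 8 = 0"
        using XY' mod'[OF P'] mod'[OF Q'] hs by auto
      then show False using m unfolding es by presburger
    qed
    have "card Y = card Y'" using cs g3 h3 by simp
    then show ?thesis
      using glue[OF P' rel_iso_star cock] g3 h3 fin by simp
  next
    case g12: False
    have m: "(G.deg_sum X + G.deg_sum Y) mod 8 = 0"
    proof -
      have "G.deg_sum X mod 8 = 0" "G.deg_sum Y mod 8 = 0"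
        using XY g12 mod[OF P] mod[OF Q] gs by auto
      then show ?thesis by presburger
    qed
    have h12: "\<not> (star B' X' \<and> card X' = 6 \<and> cocktail B' Y')"
    proof
      assume "star B' X' \<and> card X' = 6 \<and> cocktail B' Y'"
      then have "(H.deg_sum X' + H.deg_sum Y') mod 8 = 2"
        using hs mod'[OF Q'] by presburger
      then show False using m unfolding es by presburger
    qed
    have CX: "cocktail B X" "card X \<ge> 3" "cocktail B' X'" "card X' \<ge> 3"
      using XY XY' g12 h12 by blast+
    note sX = G.cocktail_sums[OF P CX(1)] H.cocktail_sums[OF P' CX(3)]
    consider "edgeless B Y" "edgeless B' Y'" | "cocktail B Y" "card Y \<ge> 3" "cocktail B' Y'" "card Y' \<ge> 3"
      | "edgeless B Y" "cocktail B' Y'" "card Y' \<ge> 3" | "cocktail B Y" "card Y \<ge> 3" "edgeless B' Y'"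
      using XY XY' g12 h12 by blast
    then show ?thesis
    proof cases
      case 1
      have "int (card X) = int (card X')"
        by (rule cocktail_size_unique)
          (use es CX(2,4) sX G.edgeless_sums[OF P 1(1)] H.edgeless_sums[OF P' 1(2)] in simp_all)
      then have "card X = card X'" "card Y = card Y'" using cs by auto
      then show ?thesis
        using glue[OF P' cock[OF _ _ _ CX(1,3)] rel_iso_edgeless[OF _ _ _ 1]] fin by blast
    next
      case 2
      note sY = G.cocktail_sums[OF Q 2(1)] H.cocktail_sums[OF Q' 2(3)]
      have "int (card X) = int (card X') \<and> int (card Y) = int (card Y') \<or>
        int (card X) = int (card Y') \<and> int (card Y) = int (card X')"
        by (rule cocktail_pair_unique) (use es cs sX sY in linarith)+
      then consider "card X = card X'" "card Y = card Y'" | "card X = card Y'" "card Y = card X'" by auto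
      then show ?thesis
      proof cases
        case same: 1
        show ?thesis
          using glue[OF P' cock[OF _ _ _ CX(1,3)] cock[OF _ _ _ 2(1,3)]] same fin by blast
      next
        case swap: 2
        show ?thesis
          using glue[OF Q' cock[OF _ _ _ CX(1) 2(3)] cock[OF _ _ _ 2(1) CX(3)]] swap fin by blast
      qed
    next
      case 3
      note sY = G.edgeless_sums[OF P 3(1)] H.cocktail_sums[OF Q' 3(2)]
      have "int (card X) * (int (card X) - 2) * (4 * int (card X) - 10) \<noteq>
        int (card X') * (int (card X') - 2) * (4 * int (card X') - 10) +
        int (card Y') * (int (card Y') - 2) * (4 * int (card Y') - 10)"
        by (rule cocktail_pair_neq) (use es CX(2,4) 3(3) sX sY in linarith)+
      then show ?thesis using qs sX sY by linarith
    next
      case 4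
      note sY = G.cocktail_sums[OF Q 4(1)] H.edgeless_sums[OF P' 4(3)]
      have "int (card X') * (int (card X') - 2) * (4 * int (card X') - 10) \<noteq>
        int (card X) * (int (card X) - 2) * (4 * int (card X) - 10) +
        int (card Y) * (int (card Y) - 2) * (4 * int (card Y) - 10)"
        by (rule cocktail_pair_neq) (use es CX(2,4) 4(2) sX sY in linarith)+
      then show ?thesis using qs sX sY by linarith
    qed
  qed
qed

section \<open>Spectral consequences for distances\<close>

text \<open>A diagonal bilinear form in eigenbasis coordinates. The function \<open>U x\<close>
  represents the standard basis vector of vertex \<open>x\<close>; with weights
  \<open>e i + c\<close> the form is that of D + cI.\<close>

definition wform :: "nat \<Rightarrow> (nat \<Rightarrow> real) \<Rightarrow> (nat \<Rightarrow> real) \<Rightarrow> (nat \<Rightarrow> real) \<Rightarrow> real" where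
  "wform n w f g = (\<Sum>i<n. w i * f i * g i)"

lemma wform_simps:
  "wform n w (\<lambda>i. f i + g i) h = wform n w f h + wform n w g h"
  "wform n w (\<lambda>i. f i - g i) h = wform n w f h - wform n w g h"
  "wform n w (\<lambda>i. c * f i) h = c * wform n w f h"
  "wform n w h (\<lambda>i. f i + g i) = wform n w h f + wform n w h g"
  "wform n w h (\<lambda>i. f i - g i) = wform n w h f - wform n w h g"
  "wform n w h (\<lambda>i. c * f i) = c * wform n w h f"
  by (simp_all add: wform_def algebra_simps sum.distrib sum_subtractf sum_distrib_left)

lemma wform_commute: "wform n w f g = wform n w g f"
  by (simp add: wform_def mult_ac)

lemma wform_nonpos:
  assumes "\<And>i. i < n \<Longrightarrow> w i \<le> 0 \<or> f i = 0"
  shows "wform n w f f \<le> 0"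
  unfolding wform_def
proof (rule sum_nonpos)
  fix i assume "i \<in> {..<n}"
  then show "w i * f i * f i \<le> 0"
    using assms[of i] by (cases "f i = 0") (auto simp: mult.assoc mult_nonpos_nonneg)
qed

lemma wform_nonneg: "(\<And>i. i < n \<Longrightarrow> w i \<ge> 0) \<Longrightarrow> wform n w f f \<ge> 0"
  unfolding wform_def by (intro sum_nonneg) (auto simp: mult.assoc)

text \<open>With at most one positive weight, the combination of \<open>f\<close> and
  \<open>g\<close> that vanishes at that coordinate has nonpositive value, while orthogonality makes
  the value positive.\<close>

lemma no_two_positive:
  assumes "\<And>i. i < n \<Longrightarrow> i \<noteq> i1 \<Longrightarrow> w i \<le> 0"
    and f: "wform n w f f > 0" and g: "wform n w g g > 0" and fg: "wform n w f g = 0"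
  shows False
proof -
  have "\<not> (f i1 = 0)" using wform_nonpos[of n w f] assms(1) f by force
  let ?h = "\<lambda>i. g i1 * f i - f i1 * g i"
  have "wform n w ?h ?h \<le> 0"
  proof (rule wform_nonpos)
    show "w i \<le> 0 \<or> ?h i = 0" if "i < n" for i
      using assms(1)[OF that] by (cases "i = i1") auto
  qed
  moreover have "wform n w ?h ?h = (g i1)\<^sup>2 * wform n w f f + (f i1)\<^sup>2 * wform n w g g"
    using fg wform_commute[of n w g f] by (simp add: wform_simps power2_eq_square)
  moreover have "(f i1)\<^sup>2 * wform n w g g > 0" "(g i1)\<^sup>2 * wform n w f f \<ge> 0"
    using \<open>\<not> (f i1 = 0)\<close> f g by simp_all
  ultimately show False by linarith
qed

text \<open>The cross product of the two coefficient rows is a solution; if it vanishes, the rows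
  are proportional and a solution is written down by cases.\<close>

lemma two_equations_three_unknowns:
  fixes p q r s t u :: real
  obtains a b c where "a \<noteq> 0 \<or> b \<noteq> 0 \<or> c \<noteq> 0" "a * p + b * q + c * r = 0" "a * s + b * t + c * u = 0"
proof (cases "q * u - r * t = 0 \<and> r * s - p * u = 0 \<and> p * t - q * s = 0")
  case False
  then show ?thesis using that[of "q * u - r * t" "r * s - p * u" "p * t - q * s"]
    by (auto simp: algebra_simps)
next
  case True
  then have eq: "q * u = r * t" "r * s = p * u" "p * t = q * s" by simp_all
  show ?thesis
  proof (cases "p = 0 \<and> q = 0")
    case False
    then show ?thesis using that[of q "-p" 0] eq by (auto simp: algebra_simps)
  next
    case pq: True
    show ?thesis
    proof (cases "r = 0")
      case True
      show ?thesis
      proof (cases "s = 0 \<and> t = 0")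
        case True
        then show ?thesis using that[of 1 0 0] pq by auto
      next
        case False
        then show ?thesis using that[of t "-s" 0] pq True by (auto simp: algebra_simps)
      qed
    next
      case False
      then show ?thesis using that[of 1 0 0] pq eq by auto
    qed
  qed
qed

text \<open>As in \<open>no_two_positive\<close>: a nontrivial combination of three vectors can be
  made to vanish at both coordinates of possibly positive weight.\<close>

lemma no_three_positive:
  assumes "\<And>i. i < n \<Longrightarrow> i \<noteq> i1 \<Longrightarrow> i \<noteq> i2 \<Longrightarrow> w i \<le> 0"
    and pos: "wform n w f f > 0" "wform n w g g > 0" "wform n w h h > 0"
    and orth: "wform n w f g = 0" "wform n w f h = 0" "wform n w g h = 0"
  shows False
proof -
  obtain a b c where abc: "a \<noteq> 0 \<or> b \<noteq> 0 \<or> c \<noteq> 0"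
    and z: "a * f i1 + b * g i1 + c * h i1 = 0" "a * f i2 + b * g i2 + c * h i2 = 0"
    using two_equations_three_unknowns by blast
  let ?k = "\<lambda>i. a * f i + b * g i + c * h i"
  have "wform n w ?k ?k \<le> 0" using assms(1) z by (intro wform_nonpos) blast
  moreover have "wform n w ?k ?k = a\<^sup>2 * wform n w f f + b\<^sup>2 * wform n w g g + c\<^sup>2 * wform n w h h"
    using orth wform_commute[of n w g f] wform_commute[of n w h f] wform_commute[of n w h g]
    by (simp add: wform_simps power2_eq_square)
  moreover have "a\<^sup>2 * wform n w f f \<ge> 0" "b\<^sup>2 * wform n w g g \<ge> 0" "c\<^sup>2 * wform n w h h \<ge> 0"
    using pos by simp_all
  moreover have "a\<^sup>2 * wform n w f f > 0 \<or> b\<^sup>2 * wform n w g g > 0 \<or> c\<^sup>2 * wform n w h h > 0"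
    using abc pos by auto
  ultimately show False by linarith
qed

text \<open>Vertices are numbered below \<open>n\<close>, and \<open>d_step\<close> splits the last
  edge off a shortest path. The exceptional eigenvalues are given by indices \<open>i1\<close>,
  \<open>i2\<close>, so their values may coincide.\<close>

locale distance_eigen =
  fixes n :: nat and d :: "nat \<Rightarrow> nat \<Rightarrow> nat" and e :: "nat \<Rightarrow> real" and U :: "nat \<Rightarrow> nat \<Rightarrow> real"
    and i1 i2 :: nat
  assumes d_sym: "x < n \<Longrightarrow> y < n \<Longrightarrow> d x y = d y x"
    and d_0: "x < n \<Longrightarrow> y < n \<Longrightarrow> d x y = 0 \<longleftrightarrow> x = y"
    and d_triangle: "x < n \<Longrightarrow> y < n \<Longrightarrow> z < n \<Longrightarrow> d x z \<le> d x y + d y z"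
    and d_step: "x < n \<Longrightarrow> y < n \<Longrightarrow> d x y = Suc k \<Longrightarrow> \<exists>z<n. d x z = k \<and> d z y = 1"
    and decomp: "x < n \<Longrightarrow> y < n \<Longrightarrow> real (d x y) = (\<Sum>i<n. e i * U x i * U y i)"
    and rows: "x < n \<Longrightarrow> y < n \<Longrightarrow> (\<Sum>i<n. U x i * U y i) = (if x = y then 1 else 0)"
    and cols: "i < n \<Longrightarrow> j < n \<Longrightarrow> (\<Sum>x<n. U x i * U x j) = (if i = j then 1 else 0)"
    and i12: "i1 < n" "i2 < n" "i1 \<noteq> i2"
    and e12: "e i1 \<noteq> -1" "e i2 \<noteq> -1"
    and e_other: "i < n \<Longrightarrow> i \<noteq> i1 \<Longrightarrow> i \<noteq> i2 \<Longrightarrow> e i = -1 \<or> e i = -3"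
begin

text \<open>The matrix D + I, for which the eigenvalue -1 of D becomes 0; its entries are 1 or 2
  once the diameter is known to be at most two.\<close>

definition N :: "nat \<Rightarrow> nat \<Rightarrow> real" where
  "N x y = real (d x y) + (if x = y then 1 else 0)"

lemma wform_shift:
  assumes "x < n" "y < n"
  shows "wform n (\<lambda>i. e i + c) (U x) (U y) = real (d x y) + (if x = y then c else 0)"
proof -
  have "wform n (\<lambda>i. e i + c) (U x) (U y) = (\<Sum>i<n. e i * U x i * U y i) + c * (\<Sum>i<n. U x i * U y i)"
    by (simp add: wform_def algebra_simps sum.distrib sum_distrib_left)
  then show ?thesis using rows[OF assms] decomp[OF assms] by simp
qed

lemma wform_N: "x < n \<Longrightarrow> y < n \<Longrightarrow> wform n (\<lambda>i. e i + 1) (U x) (U y) = N x y"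
  by (simp add: wform_shift N_def)

lemma N_decomp: "x < n \<Longrightarrow> y < n \<Longrightarrow> N x y = (\<Sum>i<n. (e i + 1) * U x i * U y i)"
  using wform_N[of x y] by (simp add: wform_def)

lemma N_sym: "x < n \<Longrightarrow> y < n \<Longrightarrow> N x y = N y x"
  using d_sym by (simp add: N_def)

lemma N_column:
  assumes x: "x < n" and j: "j < n"
  shows "(\<Sum>y<n. N x y * U y j) = (e j + 1) * U x j"
proof -
  have "(\<Sum>y<n. N x y * U y j) = (\<Sum>y<n. \<Sum>i<n. (e i + 1) * U x i * (U y i * U y j))"
    using x by (simp add: N_decomp sum_distrib_left sum_distrib_right mult_ac)
  also have "\<dots> = (\<Sum>i<n. \<Sum>y<n. (e i + 1) * U x i * (U y i * U y j))"
    by (rule sum.swap)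
  also have "\<dots> = (\<Sum>i<n. (e i + 1) * U x i * (if i = j then 1 else 0))"
    using j by (simp add: sum_distrib_left[symmetric] cols)
  also have "\<dots> = (e j + 1) * U x j"
    using j by (simp add: if_distrib[of "\<lambda>t. _ * t"] cong: if_cong)
  finally show ?thesis .
qed

lemma N_square:
  assumes x: "x < n" and y: "y < n"
  shows "(\<Sum>z<n. N x z * N y z) = (\<Sum>i<n. (e i + 1)\<^sup>2 * U x i * U y i)"
proof -
  have "(\<Sum>z<n. N x z * N y z) = (\<Sum>z<n. \<Sum>i<n. N x z * ((e i + 1) * U y i * U z i))"
    using y by (simp add: N_decomp[of y] sum_distrib_left)
  also have "\<dots> = (\<Sum>i<n. \<Sum>z<n. (e i + 1) * U y i * (N x z * U z i))"
    by (subst sum.swap) (simp add: mult_ac)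
  also have "\<dots> = (\<Sum>i<n. (e i + 1) * U y i * ((e i + 1) * U x i))"
    using x by (simp add: sum_distrib_left[symmetric] N_column)
  finally show ?thesis by (simp add: power2_eq_square mult_ac)
qed

lemma N_trace_square: "(\<Sum>x<n. \<Sum>y<n. N x y * N x y) = (\<Sum>i<n. (e i + 1)\<^sup>2)"
proof -
  have "(\<Sum>x<n. \<Sum>y<n. N x y * N x y) = (\<Sum>x<n. \<Sum>i<n. (e i + 1)\<^sup>2 * (U x i * U x i))"
    by (simp add: N_square mult_ac)
  also have "\<dots> = (\<Sum>i<n. (e i + 1)\<^sup>2 * (\<Sum>x<n. U x i * U x i))"
    by (subst sum.swap) (simp add: sum_distrib_left)
  finally show ?thesis by (simp add: cols)
qed

lemma N_trace_cube:
  "(\<Sum>x<n. \<Sum>y<n. N x y * (\<Sum>z<n. N x z * N y z)) = (\<Sum>i<n. (e i + 1) ^ 3)"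
proof -
  have "(\<Sum>x<n. \<Sum>y<n. N x y * (\<Sum>z<n. N x z * N y z))
    = (\<Sum>x<n. \<Sum>y<n. \<Sum>i<n. (e i + 1)\<^sup>2 * U x i * (N x y * U y i))"
    by (simp add: N_square sum_distrib_left mult_ac)
  also have "\<dots> = (\<Sum>x<n. \<Sum>i<n. (e i + 1)\<^sup>2 * U x i * (\<Sum>y<n. N x y * U y i))"
    by (rule sum.cong[OF refl], subst sum.swap) (simp add: sum_distrib_left)
  also have "\<dots> = (\<Sum>x<n. \<Sum>i<n. (e i + 1) ^ 3 * (U x i * U x i))"
  proof (intro sum.cong refl)
    fix x i assume "x \<in> {..<n}" "i \<in> {..<n}"
    then have "(\<Sum>y<n. N x y * U y i) = (e i + 1) * U x i" by (simp add: N_column)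
    then show "(e i + 1)\<^sup>2 * U x i * (\<Sum>y<n. N x y * U y i) = (e i + 1) ^ 3 * (U x i * U x i)"
      by (simp add: power2_eq_square power3_eq_cube)
  qed
  also have "\<dots> = (\<Sum>i<n. (e i + 1) ^ 3 * (\<Sum>x<n. U x i * U x i))"
    by (subst sum.swap) (simp add: sum_distrib_left)
  finally show ?thesis by (simp add: cols)
qed

text \<open>Otherwise \<open>N\<close> is the all-ones matrix, so every eigenvector for an
  eigenvalue of D other than -1 is constant. Columns \<open>i1\<close> and \<open>i2\<close> would
  be two nonzero constant vectors that are orthogonal.\<close>

lemma exists_far:
  obtains x y where "x < n" "y < n" "d x y \<ge> 2"
proof -
  have False if far: "\<And>x y. x < n \<Longrightarrow> y < n \<Longrightarrow> d x y < 2"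
  proof -
    have N1: "N x y = 1" if "x < n" "y < n" for x y
      using far[OF that] d_0[OF that] by (auto simp: N_def less_2_cases_iff)
    have const: "\<exists>c. c \<noteq> 0 \<and> (\<forall>x<n. U x j = c)" if j: "j < n" "e j \<noteq> -1" for j
    proof -
      have e: "e j + 1 \<noteq> 0" using j(2) by linarith
      have U: "U x j = (\<Sum>y<n. U y j) / (e j + 1)" if "x < n" for x
        using N_column[OF that j(1)] N1 that e by (simp add: field_simps)
      have "(\<Sum>y<n. U y j) / (e j + 1) \<noteq> 0"
      proof
        assume 0: "(\<Sum>y<n. U y j) / (e j + 1) = 0"
        have "U x j = 0" if "x < n" for x using U[OF that] 0 by (simp only:)
        then have "(\<Sum>x<n. U x j * U x j) = 0" by simp
        then show False using cols[OF j(1) j(1)] by simp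
      qed
      then show ?thesis using U by blast
    qed
    obtain a where a: "a \<noteq> 0" "\<forall>x<n. U x i1 = a" using const[OF i12(1) e12(1)] by blast
    obtain b where b: "b \<noteq> 0" "\<forall>x<n. U x i2 = b" using const[OF i12(2) e12(2)] by blast
    have "(\<Sum>x<n. U x i1 * U x i2) = real n * (a * b)" using a b by simp
    then show False using cols[OF i12(1,2)] i12 a b by simp
  qed
  then show ?thesis using that by (metis not_less)
qed

lemma d_step2:
  assumes "x < n" "y < n" "d x y = Suc (Suc k)"
  obtains z z' where "z < n" "z' < n" "d x z = k" "d z z' = 1" "d z' y = 1" "d z y = 2"
proof -
  obtain z' where z': "z' < n" "d x z' = Suc k" "d z' y = 1" using d_step[OF assms] by blast
  obtain z where z: "z < n" "d x z = k" "d z z' = 1" using d_step[OF assms(1) z'(1,2)] by blast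
  have "d z y \<le> 2" using d_triangle[OF z(1) z'(1) assms(2)] z z' by simp
  moreover have "d z y \<ge> 2" using d_triangle[OF assms(1) z(1) assms(2)] z assms by simp
  ultimately show ?thesis using that z z' by simp
qed

lemma e12_gt: "e i1 > -1" "e i2 > -1"
proof -
  obtain x y where "x < n" "y < n" "d x y \<ge> 2" using exists_far by blast
  moreover then obtain k where "d x y = Suc (Suc k)" by (metis add_2_eq_Suc le_Suc_ex)
  ultimately obtain z z' y where v: "z < n" "z' < n" "y < n" and dd: "d z z' = 1" "d z' y = 1" "d z y = 2"
    using d_step2 by metis
  have ne: "z \<noteq> z'" "z' \<noteq> y" "z \<noteq> y" using dd d_0 v by (metis zero_neq_one zero_neq_numeral)+
  let ?Q = "wform n (\<lambda>i. e i + 1)"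
  \<comment> \<open>Chosen orthogonal to the middle vertex \<open>z'\<close> for \<open>N\<close>,
    as 1 + 1 - 2 = 0; the form is 2 on it and 1 on \<open>z'\<close>. Two positive directions need
    two positive weights, and only \<open>i1\<close> and \<open>i2\<close> can supply them.\<close>
  let ?g = "\<lambda>i. U z i + U y i - 2 * U z' i"
  have Nv: "N z z = 1" "N y y = 1" "N z' z' = 1" "N z z' = 1" "N z' z = 1" "N z' y = 1" "N y z' = 1"
    "N z y = 2" "N y z = 2"
    using v dd ne d_0 d_sym[OF v(1,2)] d_sym[OF v(1,3)] d_sym[OF v(2,3)] by (auto simp: N_def)
  have Q: "?Q (U z') (U z') > 0" "?Q ?g ?g > 0" "?Q (U z') ?g = 0"
    using v by (simp_all add: wform_simps wform_N Nv)
  have le: "e i + 1 \<le> 0" if "i < n" "i \<noteq> i1" "i \<noteq> i2" for i using e_other[OF that] by auto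
  show "e i1 > -1"
  proof (rule ccontr)
    assume "\<not> e i1 > -1"
    then have "e i + 1 \<le> 0" if "i < n" "i \<noteq> i2" for i using le that by (cases "i = i1") auto
    then show False using no_two_positive[of n i2, OF _ Q] by blast
  qed
  show "e i2 > -1"
  proof (rule ccontr)
    assume "\<not> e i2 > -1"
    then have "e i + 1 \<le> 0" if "i < n" "i \<noteq> i1" for i using le that by (cases "i = i2") auto
    then show False using no_two_positive[of n i1, OF _ Q] by blast
  qed
qed

text \<open>At distance three the form of $D + 3I$ takes the value $-4$ on a path.\<close>
lemma d_le_2:
  assumes "x < n" "y < n"
  shows "d x y \<le> 2"
proof (rule ccontr)
  assume "\<not> d x y \<le> 2"
  then have "d x y = Suc (Suc (Suc (d x y - 3)))" by simp
  then obtain k where k: "d x y = Suc (Suc (Suc k))" by blast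
  obtain b c where b: "b < n" "c < n" "d x b = Suc k" "d b c = 1" "d c y = 1" "d b y = 2"
    using d_step2[OF assms k] by blast
  obtain a where a: "a < n" "d x a = k" "d a b = 1" using d_step[OF assms(1) b(1,3)] by blast
  note tr = d_triangle
  have ac: "d a c = 2"
  proof -
    have "d a c \<le> 2" using tr[OF a(1) b(1,2)] a b by simp
    moreover have "d x y \<le> d x a + (d a c + d c y)"
      using tr[OF assms(1) a(1) assms(2)] tr[OF a(1) b(2) assms(2)] by simp
    ultimately show ?thesis using a b k by simp
  qed
  have ay: "d a y = 3"
    using tr[OF a(1) b(1) assms(2)] tr[OF assms(1) a(1) assms(2)] a b k by simp
  have ne: "a \<noteq> b" "a \<noteq> c" "a \<noteq> y" "b \<noteq> c" "b \<noteq> y" "c \<noteq> y"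
    using a b ac ay assms d_0 by (metis zero_neq_one zero_neq_numeral)+
  let ?Q = "wform n (\<lambda>i. e i + 3)"
  \<comment> \<open>The least distance eigenvalue of the path on four vertices is -2 - sqrt 2, below
    -3; (2, 1, -1, -2) is an integral approximation to its eigenvector.\<close>
  let ?f = "\<lambda>i. 2 * U a i + U b i - U c i - 2 * U y i"
  have d3: "d a a = 0" "d b b = 0" "d c c = 0" "d y y = 0" "d b a = 1" "d c a = 2" "d y a = 3"
    "d c b = 1" "d y b = 2" "d y c = 1"
    using d_0 a b ac ay assms d_sym[OF a(1) b(1)] d_sym[OF a(1) b(2)] d_sym[OF a(1) assms(2)]
      d_sym[OF b(1,2)] d_sym[OF b(1) assms(2)] d_sym[OF b(2) assms(2)] by simp_all
  have "?Q ?f ?f = -4"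
    using a b assms ac ay ne by (simp add: wform_simps wform_shift d3)
  moreover have "?Q ?f ?f \<ge> 0"
  proof (rule wform_nonneg)
    fix i assume "i < n"
    then show "e i + 3 \<ge> 0" using e_other[of i] e12_gt by (cases "i = i1 \<or> i = i2") auto
  qed
  ultimately show False by simp
qed

definition B :: "nat \<Rightarrow> nat \<Rightarrow> bool" where
  "B x y \<longleftrightarrow> x < n \<and> y < n \<and> d x y = 2"

sublocale vertex_relation "{..<n}" B
proof
  show "B x y \<longleftrightarrow> B y x" for x y using d_sym[of x y] by (auto simp: B_def)
  show "\<not> B x x" for x using d_0[of x x] by (auto simp: B_def)
qed (auto simp: B_def)

lemma N_B:
  assumes "x < n" "y < n"
  shows "N x y = 1 + (if B x y then 1 else 0)"
proof -
  consider "d x y = 0" | "d x y = 1" | "d x y = 2" using d_le_2[OF assms] by linarith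
  then show ?thesis using d_0[OF assms] assms by cases (auto simp: N_def B_def)
qed

lemma sum_nb: "(\<Sum>y<n. if B x y then f y else 0) = (\<Sum>y\<in>nb x. f y)"
proof -
  have nb: "nb x = {y \<in> {..<n}. B x y}" using nb_V by (auto simp: nb_def)
  show ?thesis unfolding nb by (rule sum.inter_filter[symmetric]) simp
qed

lemma N_row_product:
  assumes "x < n" "y < n"
  shows "(\<Sum>z<n. N x z * N y z) = real n + deg x + deg y + codeg x y"
proof -
  have "(\<Sum>z<n. N x z * N y z) = (\<Sum>z<n. 1 + (if B x z then 1 else 0) + (if B y z then 1 else 0)
      + (if B x z then if B y z then 1 else 0 else 0))"
    using assms by (intro sum.cong) (auto simp: N_B)
  also have "\<dots> = real n + deg x + deg y + (\<Sum>z\<in>nb x. if B y z then 1 else 0)"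
    by (simp add: sum.distrib sum_nb deg_def)
  also have "(\<Sum>z\<in>nb x. if B y z then 1 else 0) = real (codeg x y)"
  proof -
    have "nb x \<inter> nb y = {z \<in> nb x. B y z}" by (auto simp: nb_def)
    then show ?thesis by (simp add: codeg_def sum.inter_filter[symmetric])
  qed
  finally show ?thesis .
qed

sublocale rank_two_relation "{..<n}" B
proof
  have "gram x y = ((e i1 + 1)\<^sup>2 + 2 * (e i1 + 1)) * U x i1 * U y i1
    + ((e i2 + 1)\<^sup>2 + 2 * (e i2 + 1)) * U x i2 * U y i2" if xy: "x < n" "y < n" for x y
  proof -
    have "gram x y = (\<Sum>z<n. N x z * N y z) + 2 * N x y"
      unfolding N_row_product[OF xy] N_B[OF xy] by (simp add: gram_def)
    also have "\<dots> = (\<Sum>i<n. ((e i + 1)\<^sup>2 + 2 * (e i + 1)) * U x i * U y i)"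
      unfolding N_square[OF xy] N_decomp[OF xy]
      by (simp add: sum_distrib_left sum.distrib[symmetric] algebra_simps)
    \<comment> \<open>The weight is (e + 1)(e + 3), which vanishes at -1 and -3.\<close>
    also have "\<dots> = (\<Sum>i\<in>{i1, i2}. ((e i + 1)\<^sup>2 + 2 * (e i + 1)) * U x i * U y i)"
    proof (rule sum.mono_neutral_right)
      show "\<forall>i\<in>{..<n} - {i1, i2}. ((e i + 1)\<^sup>2 + 2 * (e i + 1)) * U x i * U y i = 0"
        using e_other by (fastforce simp: power2_eq_square)
    qed (use i12 in auto)
    finally show ?thesis using i12 by simp
  qed
  then show "\<exists>p q v w. \<forall>x\<in>{..<n}. \<forall>y\<in>{..<n}. gram x y = p * v x * v y + q * w x * w y"
    by (intro exI[of _ "(e i1 + 1)\<^sup>2 + 2 * (e i1 + 1)"] exI[of _ "(e i2 + 1)\<^sup>2 + 2 * (e i2 + 1)"]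
        exI[of _ "\<lambda>x. U x i1"] exI[of _ "\<lambda>x. U x i2"]) simp
qed

section \<open>Traces of powers of D + I as degree counts\<close>

lemma trace_square_deg: "(\<Sum>i<n. (e i + 1)\<^sup>2) = (real n)\<^sup>2 + 3 * deg_sum {..<n}"
proof -
  \<comment> \<open>Entries are 1 or 2, so a \<open>B\<close>-pair contributes 4 = 1 + 3.\<close>
  have "(\<Sum>i<n. (e i + 1)\<^sup>2) = (\<Sum>x<n. \<Sum>y<n. 1 + (if B x y then 3 else 0))"
    unfolding N_trace_square[symmetric] by (intro sum.cong) (auto simp: N_B)
  also have "\<dots> = (\<Sum>x<n. real n + 3 * deg x)"
    by (simp add: sum.distrib sum_nb deg_def mult.commute)
  finally show ?thesis
    by (simp add: sum.distrib deg_sum_def sum_distrib_left[symmetric] power2_eq_square)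
qed

text \<open>Both sides count the walks of length two in \<open>B\<close> that start at
  \<open>x\<close>, by end vertex and by middle vertex.\<close>

lemma sum_codeg: "(\<Sum>y<n. real (codeg x y)) = (\<Sum>z\<in>nb x. real (deg z))"
proof -
  have "(\<Sum>y<n. real (codeg x y)) = (\<Sum>y<n. \<Sum>z\<in>nb x. if B z y then 1 else 0)"
  proof (rule sum.cong[OF refl])
    fix y
    have "nb x \<inter> nb y = {z \<in> nb x. B z y}" using sym by (auto simp: nb_def)
    then show "real (codeg x y) = (\<Sum>z\<in>nb x. if B z y then 1 else 0)"
      by (simp add: codeg_def sum.inter_filter[symmetric])
  qed
  also have "\<dots> = (\<Sum>z\<in>nb x. \<Sum>y<n. if B z y then 1 else 0)" by (rule sum.swap)
  also have "\<dots> = (\<Sum>z\<in>nb x. real (deg z))" by (simp add: sum_nb deg_def)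
  finally show ?thesis .
qed

lemma sum_nb_deg: "(\<Sum>x<n. \<Sum>z\<in>nb x. real (deg z)) = (\<Sum>z<n. (real (deg z))\<^sup>2)"
proof -
  have "(\<Sum>x<n. \<Sum>z\<in>nb x. real (deg z)) = (\<Sum>x<n. \<Sum>z<n. if B x z then real (deg z) else 0)"
    by (simp add: sum_nb)
  also have "\<dots> = (\<Sum>z<n. \<Sum>x<n. if B z x then real (deg z) else 0)"
    by (subst sum.swap) (simp add: sym)
  also have "\<dots> = (\<Sum>z<n. (real (deg z))\<^sup>2)"
    by (simp add: sum_nb deg_def power2_eq_square)
  finally show ?thesis .
qed

text \<open>The expansion of the trace of (J + B)^3: the mixed terms are 3n times the sum of the
  entries of B and 3 times that of B^2, the latter being the sum of squared degrees, and the trace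
  of B^3 is the sum of codegrees over adjacent ordered pairs. The last two make up
  \<open>cubic_sum\<close>.\<close>

lemma trace_cube_deg:
  "(\<Sum>i<n. (e i + 1) ^ 3) = (real n) ^ 3 + 3 * real n * deg_sum {..<n} + cubic_sum {..<n}"
proof -
  let ?q = "\<Sum>z<n. (real (deg z))\<^sup>2"
  have row: "(\<Sum>y<n. N x y * (\<Sum>z<n. N x z * N y z)) = (real n)\<^sup>2 + 2 * real n * deg x
    + (\<Sum>y<n. real (deg y)) + 2 * (\<Sum>z\<in>nb x. real (deg z)) + (real (deg x))\<^sup>2 + (\<Sum>y\<in>nb x. real (codeg x y))"
    if x: "x < n" for x
  proof -
    have "(\<Sum>y<n. N x y * (\<Sum>z<n. N x z * N y z)) = (\<Sum>y<n. (real n + deg x + deg y + codeg x y)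
      + (if B x y then real n + deg x + deg y + codeg x y else 0))"
    proof (rule sum.cong[OF refl])
      fix y assume "y \<in> {..<n}"
      then have y: "y < n" by simp
      show "N x y * (\<Sum>z<n. N x z * N y z) = (real n + deg x + deg y + codeg x y)
        + (if B x y then real n + deg x + deg y + codeg x y else 0)"
        unfolding N_row_product[OF x y] N_B[OF x y] by simp
    qed
    also have "\<dots> = real n * (real n + deg x) + (\<Sum>y<n. real (deg y)) + (\<Sum>z\<in>nb x. real (deg z))
      + (real (deg x) * (real n + deg x) + (\<Sum>z\<in>nb x. real (deg z)) + (\<Sum>y\<in>nb x. real (codeg x y)))"
      unfolding sum.distrib sum_nb sum_codeg by (simp add: deg_def algebra_simps)
    finally show ?thesis by (simp add: algebra_simps power2_eq_square)
  qed
  have "(\<Sum>i<n. (e i + 1) ^ 3) = (\<Sum>x<n. (real n)\<^sup>2 + 2 * real n * deg x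
    + (\<Sum>y<n. real (deg y)) + 2 * (\<Sum>z\<in>nb x. real (deg z)) + (real (deg x))\<^sup>2 + (\<Sum>y\<in>nb x. real (codeg x y)))"
    unfolding N_trace_cube[symmetric] by (intro sum.cong) (auto simp: row)
  also have "\<dots> = (real n)\<^sup>2 * n + 2 * real n * (\<Sum>y<n. real (deg y)) + n * (\<Sum>y<n. real (deg y))
    + 2 * ?q + ?q + (\<Sum>x<n. \<Sum>y\<in>nb x. real (codeg x y))"
    unfolding sum.distrib sum_distrib_left[symmetric] sum_nb_deg by simp
  finally show ?thesis
    by (simp add: deg_sum_def cubic_sum_def sum.distrib sum_distrib_left[symmetric]
        power2_eq_square power3_eq_cube algebra_simps)
qed

section \<open>Disconnectedness of the complement\<close>

lemma exists_B: obtains x y where "B x y"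
proof -
  obtain x y where "x < n" "y < n" "d x y \<ge> 2" using exists_far by blast
  then have "B x y" using d_le_2[of x y] by (simp add: B_def)
  then show ?thesis using that by blast
qed

text \<open>
  The ends of an induced path \<open>a b c f\<close> have a common neighbour \<open>h\<close>.  In each case of the adjacency of
  \<open>h\<close> to \<open>b\<close> and \<open>c\<close> there are three orthogonal vectors on which the form of $D + I$ is positive.
\<close>
lemma P4_free_adjacent: "P4_free {..<n} (\<lambda>x y. x < n \<and> y < n \<and> d x y = 1)"
  unfolding P4_free_def
proof (intro ballI impI, rule ccontr)
  fix a b c f
  assume v: "a \<in> {..<n}" "b \<in> {..<n}" "c \<in> {..<n}" "f \<in> {..<n}" and dist: "distinct [a, b, c, f]"
    and adj: "a < n \<and> b < n \<and> d a b = 1" "b < n \<and> c < n \<and> d b c = 1" "c < n \<and> f < n \<and> d c f = 1"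
    and "\<not> ((a < n \<and> c < n \<and> d a c = 1) \<or> (b < n \<and> f < n \<and> d b f = 1) \<or> (a < n \<and> f < n \<and> d a f = 1))"
  then have n1: "d a c \<noteq> 1" "d b f \<noteq> 1" "d a f \<noteq> 1" by auto
  have v: "a < n" "b < n" "c < n" "f < n" using v by auto
  have d2: "d x y = 2" if "x < n" "y < n" "x \<noteq> y" "d x y \<noteq> 1" for x y
    using d_le_2[OF that(1,2)] d_0[OF that(1,2)] that by linarith
  have ac: "d a c = 2" "d b f = 2" "d a f = 2" using d2[of a c] d2[of b f] d2[of a f] v dist n1 by auto
  obtain h where h: "h < n" "d a h = 1" "d h f = 1" using d_step[OF v(1,4), of 1] ac(3) by auto
  have hne: "h \<noteq> a" "h \<noteq> b" "h \<noteq> c" "h \<noteq> f"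
    using h ac d_0[OF v(1,1)] d_0[OF v(4,4)] by auto
  let ?Q = "wform n (\<lambda>i. e i + 1)"
  have le: "e i + 1 \<le> 0" if "i < n" "i \<noteq> i1" "i \<noteq> i2" for i using e_other[OF that] by auto
  have N0: "N x x = 1" if "x < n" for x using d_0[OF that that] by (simp add: N_def)
  have Nd: "N x y = d x y" "N y x = d x y" if "x < n" "y < n" "x \<noteq> y" for x y
    using that d_sym[OF that(1,2)] by (simp_all add: N_def)
  have NN: "N a a = 1" "N b b = 1" "N c c = 1" "N f f = 1" "N h h = 1"
    "N a b = 1" "N b a = 1" "N b c = 1" "N c b = 1" "N c f = 1" "N f c = 1"
    "N a c = 2" "N c a = 2" "N b f = 2" "N f b = 2" "N a f = 2" "N f a = 2"
    "N a h = 1" "N h a = 1" "N h f = 1" "N f h = 1"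
    using N0 Nd v h hne dist adj ac by auto
  have bh: "N b h = N h b" "N c h = N h c" using N_sym v h by auto
  have alt: "N h b = 1 \<or> N h b = 2" "N h c = 1 \<or> N h c = 2"
    using N_B v h by auto
  show False
  proof (cases "N h b = N h c")
    case True
    \<comment> \<open>Here \<open>h\<close> is adjacent to both of \<open>b\<close>,
      \<open>c\<close> (a gem) or to neither (a five-cycle). Equality of the two entries makes
      \<open>?g\<close> orthogonal to \<open>h\<close>; the form takes the values 2, 1, 2.\<close>
    let ?g = "\<lambda>i. U a i - U b i + U c i - U f i" and ?k = "\<lambda>i. U a i + U f i - 2 * U h i"
    show False
      by (rule no_three_positive[of n i1 i2 "\<lambda>i. e i + 1" ?g "U h" ?k, OF le])
        (use v h True in \<open>simp_all add: wform_simps wform_N NN bh\<close>)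
  next
    case False
    then consider "N h b = 1" "N h c = 2" | "N h b = 2" "N h c = 1" using alt by auto
    then show False
    proof cases
      case 1
      \<comment> \<open>A house: b c f h is an induced four-cycle and \<open>a\<close> is joined to
        \<open>b\<close> and \<open>h\<close>. The vector \<open>?g\<close> alternates around the
        cycle, and \<open>?k\<close> completes it and \<open>a\<close> to an orthogonal triple with
        values 4, 1, 4.\<close>
      let ?g = "\<lambda>i. U b i - U h i - U c i + U f i" and ?k = "\<lambda>i. 4 * U b i + 4 * U h i - U c i - U f i - 4 * U a i"
      show False
        by (rule no_three_positive[of n i1 i2 "\<lambda>i. e i + 1" ?g "U a" ?k, OF le])
          (use v h 1 in \<open>simp_all add: wform_simps wform_N NN bh\<close>)
    next
      case 2
      \<comment> \<open>The mirror image of the previous house under exchanging \<open>a\<close>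
        with \<open>f\<close> and \<open>b\<close> with \<open>c\<close>.\<close>
      let ?g = "\<lambda>i. U c i - U h i - U b i + U a i" and ?k = "\<lambda>i. 4 * U c i + 4 * U h i - U b i - U a i - 4 * U f i"
      show False
        by (rule no_three_positive[of n i1 i2 "\<lambda>i. e i + 1" ?g "U f" ?k, OF le])
          (use v h 2 in \<open>simp_all add: wform_simps wform_N NN bh\<close>)
    qed
  qed
qed

text \<open>Seinsche's theorem disconnects the graph or its complement. The graph itself has
  diameter at most two, which rules out the former.\<close>

lemma splits_B: "splits {..<n} B"
proof -
  let ?A = "\<lambda>x y. x < n \<and> y < n \<and> d x y = 1"
  obtain x0 y0 where "B x0 y0" using exists_B by blast
  have "card {..<n} \<ge> 2" using i12 by auto
  then have "splits {..<n} ?A \<or> splits {..<n} (\<lambda>x y. x \<noteq> y \<and> \<not> ?A x y)"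
    by (intro P4_free_splits P4_free_adjacent) (use d_sym in auto)
  then show ?thesis
  proof
    assume "splits {..<n} ?A"
    then obtain X Y where XY: "X \<union> Y = {..<n}" "X \<inter> Y = {}" "X \<noteq> {}" "Y \<noteq> {}"
      and no: "\<forall>x\<in>X. \<forall>y\<in>Y. \<not> ?A x y" unfolding splits_def by blast
    obtain x y where xy: "x \<in> X" "y \<in> Y" using XY by blast
    then have lt: "x < n" "y < n" using XY(1) by auto
    \<comment> \<open>Vertices on opposite sides are distinct and nonadjacent, so they have a common
      neighbour; on whichever side it lies, it is joined to the other.\<close>
    have "d x y = 2"
      using no xy lt d_le_2[OF lt] d_0[OF lt] XY(2)
      by (metis One_nat_def disjoint_iff less_2_cases_iff linorder_neqE_nat not_le)
    then obtain z where z: "z < n" "d x z = 1" "d z y = 1" using d_step[OF lt, of 1] by auto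
    then have "z \<in> X \<or> z \<in> Y" using XY(1) by auto
    then show ?thesis using no xy lt z by blast
  next
    assume "splits {..<n} (\<lambda>x y. x \<noteq> y \<and> \<not> ?A x y)"
    then obtain X Y where XY: "X \<union> Y = {..<n}" "X \<inter> Y = {}" "X \<noteq> {}" "Y \<noteq> {}"
      and no: "\<forall>x\<in>X. \<forall>y\<in>Y. \<not> (x \<noteq> y \<and> \<not> ?A x y)" unfolding splits_def by meson
    show ?thesis
    proof (rule splitsI[OF XY])
      fix x y assume "x \<in> X" "y \<in> Y"
      then have "x \<noteq> y" "\<not> (x \<noteq> y \<and> \<not> ?A x y)" using XY(2) no by blast+
      then show "\<not> B x y" by (auto simp: B_def)
    qed
  qed
qed

end

section \<open>Distances in graphs\<close>

text \<open>The definition of \<open>graph_dist\<close> minimizes over paths only; the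
  identification with the minimum cost over all walks extends the bound to walks, which can be
  concatenated and reversed freely.\<close>

lemma (in wf_digraph) graph_dist_le:
  assumes "awalk u p v"
  shows "graph_dist G u v \<le> length p"
proof -
  have "awalk_cost (\<lambda>_. 1) p = real (length p)" for p :: "'b list"
    by (induction p) auto
  then have "ereal (real (graph_dist G u v)) \<le> ereal (real (length p))"
    using graph_dist_eq_mu[OF wf_digraph_axioms reachable_awalkI[OF assms]]
      min_cost_le_walk_cost[OF assms, of "\<lambda>_. 1"] by simp
  then show ?thesis by simp
qed

lemma (in wf_digraph) graph_dist_walk:
  assumes "u \<rightarrow>\<^sup>* v"
  obtains p where "awalk u p v" "length p = graph_dist G u v"
proof -
  let ?P = "\<lambda>k. \<exists>p. apath u p v \<and> length p = k"
  obtain p0 where "apath u p0 v" using assms reachable_apath by blast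
  then have "?P (graph_dist G u v)"
    unfolding graph_dist_def by (intro LeastI[of ?P "length p0"]) blast
  then show ?thesis using that awalkI_apath by blast
qed

lemma (in sym_digraph) awalk_reverse:
  assumes "awalk u p v"
  obtains q where "awalk v q u" "length q = length p"
  using assms
proof (induction p arbitrary: u thesis)
  case Nil
  then have "awalk v [] u" by (auto simp: awalk_Nil_iff)
  then show ?case using Nil.prems(1) by simp
next
  case (Cons a p)
  then have a: "a \<in> arcs G" "u = tail G a" "awalk (head G a) p v" by (auto simp: awalk_Cons_iff)
  obtain q where q: "awalk v q (head G a)" "length q = length p" using Cons.IH[OF _ a(3)] by blast
  obtain b where "b \<in> arcs G" "tail G a = head G b" "head G a = tail G b"
    using a(1) sym_arcs unfolding symmetric_conv by blast
  then have "awalk v (q @ [b]) u"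
    using q(1) a(2) arc_implies_awalk[of b] by auto
  then show ?case using Cons.prems(1)[of "q @ [b]"] q(2) by simp
qed

locale connected_graph = graph +
  assumes conn: "connected G"
begin

lemma all_reachable: "u \<in> verts G \<Longrightarrow> v \<in> verts G \<Longrightarrow> u \<rightarrow>\<^sup>* v"
  using conn reachable_mk_symmetric_eq[OF sym_arcs]
  unfolding connected_def strongly_connected_def by auto

lemma graph_dist_commute:
  assumes "u \<in> verts G" "v \<in> verts G"
  shows "graph_dist G u v = graph_dist G v u"
proof -
  have "graph_dist G v u \<le> graph_dist G u v" if uv: "u \<in> verts G" "v \<in> verts G" for u v
  proof -
    obtain p where p: "awalk u p v" "length p = graph_dist G u v"
      using graph_dist_walk[OF all_reachable[OF uv]] by blast
    obtain q where "awalk v q u" "length q = length p" using awalk_reverse[OF p(1)] by blast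
    then show ?thesis using graph_dist_le[of v q u] p by simp
  qed
  then show ?thesis using assms by (simp add: antisym)
qed

lemma graph_dist_triangle:
  assumes "u \<in> verts G" "v \<in> verts G" "w \<in> verts G"
  shows "graph_dist G u w \<le> graph_dist G u v + graph_dist G v w"
proof -
  obtain p where p: "awalk u p v" "length p = graph_dist G u v"
    using graph_dist_walk[OF all_reachable[OF assms(1,2)]] by blast
  obtain q where q: "awalk v q w" "length q = graph_dist G v w"
    using graph_dist_walk[OF all_reachable[OF assms(2,3)]] by blast
  have "awalk u (p @ q) w" using p(1) q(1) by (rule awalk_appendI)
  then show ?thesis using graph_dist_le[of u "p @ q" w] p(2) q(2) by simp
qed

lemma graph_dist_eq_0_iff:
  assumes "u \<in> verts G" "v \<in> verts G"
  shows "graph_dist G u v = 0 \<longleftrightarrow> u = v"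
proof
  assume "graph_dist G u v = 0"
  then obtain p where "awalk u p v" "length p = 0"
    using graph_dist_walk[OF all_reachable[OF assms]] by metis
  then show "u = v" by (simp add: awalk_Nil_iff)
next
  assume "u = v"
  then have "awalk u [] v" using assms by (simp add: awalk_Nil_iff)
  then show "graph_dist G u v = 0" using graph_dist_le[of u "[]" v] by simp
qed

lemma graph_dist_eq_1_iff:
  assumes "u \<in> verts G" "v \<in> verts G"
  shows "graph_dist G u v = 1 \<longleftrightarrow> (u, v) \<in> arcs_ends G"
proof
  assume "graph_dist G u v = 1"
  then obtain p where p: "awalk u p v" "length p = 1"
    using graph_dist_walk[OF all_reachable[OF assms]] by metis
  then obtain a where "p = [a]" by (auto simp: length_Suc_conv)
  then show "(u, v) \<in> arcs_ends G" using p(1) by (auto simp: awalk_simps arcs_ends_conv)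
next
  assume "(u, v) \<in> arcs_ends G"
  then obtain a where a: "a \<in> arcs G" "u = tail G a" "v = head G a" by (auto simp: arcs_ends_conv)
  then have "awalk u [a] v" using arc_implies_awalk by blast
  then have "graph_dist G u v \<le> 1" using graph_dist_le[of u "[a]" v] by simp
  moreover have "graph_dist G u v \<noteq> 0" using graph_dist_eq_0_iff[OF assms] a no_loops by simp
  ultimately show "graph_dist G u v = 1" by simp
qed

lemma graph_dist_step:
  assumes uv: "u \<in> verts G" "v \<in> verts G" "graph_dist G u v = Suc k"
  obtains w where "w \<in> verts G" "graph_dist G u w = k" "graph_dist G w v = 1"
proof -
  obtain p where p: "awalk u p v" "length p = Suc k"
    using graph_dist_walk[OF all_reachable[OF uv(1,2)]] uv(3) by metis
  then obtain q a where qa: "p = q @ [a]" by (metis length_0_conv nat.distinct(1) rev_exhaust)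
  then obtain w where w: "awalk u q w" "awalk w [a] v" using p(1) by (auto simp: awalk_append_iff)
  have wV: "w \<in> verts G" using w(2) by blast
  have le: "graph_dist G u w \<le> k" "graph_dist G w v \<le> 1"
    using graph_dist_le[OF w(1)] graph_dist_le[OF w(2)] p(2) qa by simp_all
  then show ?thesis
    using that[OF wV] graph_dist_triangle[OF uv(1) wV uv(2)] uv(3) by simp
qed

lemma distance_eigen_exists:
  assumes vs: "vertex_enum G vs"
    and two: "size {# x \<in># distance_spectrum G. x \<noteq> -1 \<and> x \<noteq> -3 #} = 2"
  obtains e U i1 i2 where
    "distance_eigen (length vs) (\<lambda>i j. graph_dist G (vs ! i) (vs ! j)) e U i1 i2"
    "distance_spectrum G = image_mset e (mset_set {..<length vs})"
proof -
  let ?n = "length vs" and ?d = "\<lambda>i j. graph_dist G (vs ! i) (vs ! j)"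
  have set: "distinct vs" "set vs = verts G" using vs by (auto simp: vertex_enum_def)
  have V: "vs ! i \<in> verts G" if "i < ?n" for i using set(2) that nth_mem by blast
  have sym: "\<forall>i<?n. \<forall>j<?n. real (?d i j) = real (?d j i)"
    using graph_dist_commute[OF V V] by simp
  obtain U :: "nat \<Rightarrow> nat \<Rightarrow> real" and e :: "nat \<Rightarrow> real" where dec_all:
    "proots (char_poly (mat ?n ?n (\<lambda>(i, j). real (?d i j)))) = image_mset e (mset_set {..<?n}) \<and>
     (\<forall>x<?n. \<forall>y<?n. real (?d x y) = (\<Sum>i<?n. e i * U x i * U y i) \<and>
       (\<Sum>i<?n. U x i * U y i) = (if x = y then 1 else 0) \<and>
       (\<Sum>z<?n. U z x * U z y) = (if x = y then 1 else 0))"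
    using real_symmetric_spectral_decomposition[of ?n "\<lambda>i j. real (?d i j)", OF sym]
    by (elim exE) (rule that)
  then have spec: "proots (char_poly (mat ?n ?n (\<lambda>(i, j). real (?d i j)))) = image_mset e (mset_set {..<?n})"
    by (rule conjunct1)
  have dec: "real (?d x y) = (\<Sum>i<?n. e i * U x i * U y i)"
    and rows: "(\<Sum>i<?n. U x i * U y i) = (if x = y then 1 else 0)"
    and cols: "(\<Sum>z<?n. U z x * U z y) = (if x = y then 1 else 0)"
    if "x < ?n" "y < ?n" for x y
    using dec_all[THEN conjunct2, rule_format, OF that] by simp_all
  have spec': "distance_spectrum G = image_mset e (mset_set {..<?n})"
    using distance_spectrum_eq[OF vs] spec by (simp add: distance_matrix_def)
  \<comment> \<open>Counting indices instead of values turns the multiset hypothesis into a set of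
    cardinality two, even for a repeated exceptional eigenvalue.\<close>
  let ?I = "{i \<in> {..<?n}. e i \<noteq> -1 \<and> e i \<noteq> -3}"
  have "card ?I = 2"
    using two unfolding spec' by (simp add: filter_mset_image_mset o_def)
  then obtain i1 i2 where i: "?I = {i1, i2}" "i1 \<noteq> i2" by (auto simp: card_2_iff)
  have "distance_eigen ?n ?d e U i1 i2"
  proof
    fix x y k assume xy: "x < ?n" "y < ?n" "?d x y = Suc k"
    obtain w where w: "w \<in> verts G" "graph_dist G (vs ! x) w = k" "graph_dist G w (vs ! y) = 1"
      using graph_dist_step[OF V[OF xy(1)] V[OF xy(2)] xy(3)] by blast
    then obtain z where "z < ?n" "vs ! z = w" using set(2) by (metis in_set_conv_nth)
    then show "\<exists>z<?n. ?d x z = k \<and> ?d z y = 1" using w by blast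
  next
    show "i1 < ?n" "i2 < ?n" "e i1 \<noteq> -1" "e i2 \<noteq> -1" using i by auto
    show "i1 \<noteq> i2" by fact
    show "e j = -1 \<or> e j = -3" if "j < ?n" "j \<noteq> i1" "j \<noteq> i2" for j
      using i(1) that by blast
    show "?d x y = 0 \<longleftrightarrow> x = y" if "x < ?n" "y < ?n" for x y
      using graph_dist_eq_0_iff V that set(1) by (simp add: nth_eq_iff_index_eq)
    show "?d x y = ?d y x" if "x < ?n" "y < ?n" for x y
      by (rule graph_dist_commute[OF V[OF that(1)] V[OF that(2)]])
    show "?d x z \<le> ?d x y + ?d y z" if "x < ?n" "y < ?n" "z < ?n" for x y z
      by (rule graph_dist_triangle[OF V[OF that(1)] V[OF that(2)] V[OF that(3)]])
  qed (fact dec rows cols)+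
  then show ?thesis using spec' by (rule that)
qed

end

text \<open>A digraph isomorphism also has to map arcs. Without parallel arcs an arc is determined
  by its ends, so the vertex bijection induces a bijection of arcs.\<close>

lemma digraph_isoI:
  assumes G: "Digraph.graph G" and H: "Digraph.graph H"
    and h: "bij_betw h (verts H) (verts G)"
    and adj: "\<And>u v. u \<in> verts H \<Longrightarrow> v \<in> verts H \<Longrightarrow> (u, v) \<in> arcs_ends H \<longleftrightarrow> (h u, h v) \<in> arcs_ends G"
  shows "digraph_iso H G"
proof -
  interpret G: graph G by (rule G)
  interpret H: graph H by (rule H)
  have inj: "inj_on h (verts H)" using h by (rule bij_betw_imp_inj_on)
  have "\<forall>a\<in>arcs H. \<exists>b\<in>arcs G. tail G b = h (tail H a) \<and> head G b = h (head H a)"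
  proof
    fix a assume a: "a \<in> arcs H"
    then have "(tail H a, head H a) \<in> arcs_ends H" by (auto simp: arcs_ends_conv)
    then have "(h (tail H a), h (head H a)) \<in> arcs_ends G" using adj a by simp
    then show "\<exists>b\<in>arcs G. tail G b = h (tail H a) \<and> head G b = h (head H a)"
      by (auto simp: arcs_ends_conv)
  qed
  then obtain g where g: "\<And>a. a \<in> arcs H \<Longrightarrow> g a \<in> arcs G \<and> tail G (g a) = h (tail H a) \<and> head G (g a) = h (head H a)"
    by metis
  have ginj: "inj_on g (arcs H)"
  proof (rule inj_onI)
    fix a b assume ab: "a \<in> arcs H" "b \<in> arcs H" "g a = g b"
    then have "h (tail H a) = h (tail H b)" "h (head H a) = h (head H b)"
      using g[of a] g[of b] by metis+
    then have "tail H a = tail H b" "head H a = head H b"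
      using inj ab(1,2) by (auto dest: inj_onD)
    then show "a = b" using ab(1,2) H.no_multi_arcs[of a b] by (simp add: arc_to_ends_def)
  qed
  have gsurj: "g ` arcs H = arcs G"
  proof
    show "g ` arcs H \<subseteq> arcs G" using g by blast
    show "arcs G \<subseteq> g ` arcs H"
    proof
      fix b assume b: "b \<in> arcs G"
      then have "tail G b \<in> h ` verts H" "head G b \<in> h ` verts H"
        using bij_betw_imp_surj_on[OF h] by simp_all
      then obtain u v where uv: "u \<in> verts H" "v \<in> verts H" "tail G b = h u" "head G b = h v" by blast
      have "(tail G b, head G b) \<in> arcs_ends G" using b by (auto simp: arcs_ends_conv)
      then have "(h u, h v) \<in> arcs_ends G" using uv(3,4) by simp
      then obtain a where a: "a \<in> arcs H" "tail H a = u" "head H a = v"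
        using adj[OF uv(1,2)] by (auto simp: arcs_ends_conv)
      then have "g a = b"
        using g[OF a(1)] b uv(3,4) G.no_multi_arcs[of "g a" b] by (simp add: arc_to_ends_def)
      then show "b \<in> g ` arcs H" using a(1) by blast
    qed
  qed
  \<comment> \<open>Taking the head and tail functions of \<open>G\<close> itself makes the image of
    \<open>H\<close> equal to \<open>G\<close> as a record, not merely up to values outside the
    arcs.\<close>
  let ?f = "\<lparr>iso_verts = h, iso_arcs = g, iso_head = head G, iso_tail = tail G\<rparr>"
  have "pre_digraph.digraph_isomorphism H ?f"
    unfolding pre_digraph.digraph_isomorphism_def using inj ginj g H.wf_digraph by simp
  moreover have "G = app_iso ?f H"
    by (intro pre_digraph.equality) (simp_all add: gsurj bij_betw_imp_surj_on[OF h])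
  ultimately show ?thesis unfolding digraph_iso_def by blast
qed

theorem theorem4p3:
  fixes G :: "('a, 'b) pre_digraph" and H :: "('c, 'd) pre_digraph"
  assumes "Digraph.graph G" and "Digraph_Component.connected G"
    and "size {# x \<in># distance_spectrum G. x \<noteq> -1 \<and> x \<noteq> -3 #} = 2"
    and "Digraph.graph H" and "Digraph_Component.connected H"
    and "distance_spectrum H = distance_spectrum G"
  shows "digraph_iso H G"
proof -
  interpret G: connected_graph G
    using assms(1,2) by (intro connected_graph.intro connected_graph_axioms.intro)
  interpret H: connected_graph H
    using assms(4,5) by (intro connected_graph.intro connected_graph_axioms.intro)
  obtain vs where vs: "vertex_enum G vs"
    using finite_distinct_list[OF G.finite_verts] unfolding vertex_enum_def by blast
  obtain ws where ws: "vertex_enum H ws"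
    using finite_distinct_list[OF H.finite_verts] unfolding vertex_enum_def by blast
  let ?n = "length vs" and ?d = "\<lambda>i j. graph_dist G (vs ! i) (vs ! j)"
  let ?m = "length ws" and ?d' = "\<lambda>i j. graph_dist H (ws ! i) (ws ! j)"
  obtain e U i1 i2 where "distance_eigen ?n ?d e U i1 i2"
    and e: "distance_spectrum G = image_mset e (mset_set {..<?n})"
    using G.distance_eigen_exists[OF vs assms(3)] by blast
  then interpret EG: distance_eigen ?n ?d e U i1 i2 by blast
  \<comment> \<open>Equal spectra transfer the condition on exceptional eigenvalues to
    \<open>H\<close>, so both graphs fall under the structure theorem.\<close>
  obtain e' U' j1 j2 where "distance_eigen ?m ?d' e' U' j1 j2"
    and e': "distance_spectrum H = image_mset e' (mset_set {..<?m})"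
    using H.distance_eigen_exists[OF ws] assms(3,6) by metis
  then interpret EH: distance_eigen ?m ?d' e' U' j1 j2 by blast
  have spec: "image_mset e (mset_set {..<?n}) = image_mset e' (mset_set {..<?m})"
    using e e' assms(6) by simp
  have n: "?m = ?n" using arg_cong[OF spec, of size] by simp
  have power_sums: "(\<Sum>i<?n. f (e i)) = (\<Sum>i<?m. f (e' i))" for f :: "real \<Rightarrow> real"
    using arg_cong[OF spec, of "\<lambda>M. \<Sum>x\<in>#M. f x"] by (simp add: sum_unfold_sum_mset o_def image_mset.compositionality)
  have deg: "EH.deg_sum {..<?m} = EG.deg_sum {..<?n}"
    using EG.trace_square_deg EH.trace_square_deg power_sums[of "\<lambda>x. (x + 1)\<^sup>2"] n by simp
  have cubic: "EH.cubic_sum {..<?m} = EG.cubic_sum {..<?n}"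
    using EG.trace_cube_deg EH.trace_cube_deg power_sums[of "\<lambda>x. (x + 1) ^ 3"] n deg by simp
  obtain x y where B: "EG.B x y" using EG.exists_B by blast
  obtain x' y' where B': "EH.B x' y'" using EH.exists_B by blast
  have "rel_iso EH.B {..<?m} EG.B {..<?n}"
    by (rule rank_two_relation_iso[OF EH.rank_two_relation_axioms EH.splits_B B'
          EG.rank_two_relation_axioms EG.splits_B B _ deg cubic]) (simp add: n)
  then obtain f where f: "bij_betw f {..<?m} {..<?n}"
    and fB: "\<And>i j. i < ?m \<Longrightarrow> j < ?m \<Longrightarrow> EH.B i j \<longleftrightarrow> EG.B (f i) (f j)"
    unfolding rel_iso_def by auto
  have f_lt: "f i < ?n" if "i < ?m" for i using bij_betwE[OF f] that by blast
  \<comment> \<open>In diameter at most two, adjacency is the complement of \<open>B\<close> off the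
    diagonal, so a bijection preserving \<open>B\<close> preserves edges.\<close>
  have fd: "?d' i j = 1 \<longleftrightarrow> ?d (f i) (f j) = 1" if ij: "i < ?m" "j < ?m" for i j
  proof -
    have "?d' i j = 1 \<longleftrightarrow> i \<noteq> j \<and> \<not> EH.B i j"
      using EH.d_le_2[OF ij] EH.d_0[OF ij] ij by (auto simp: EH.B_def)
    moreover have "?d (f i) (f j) = 1 \<longleftrightarrow> f i \<noteq> f j \<and> \<not> EG.B (f i) (f j)"
      using EG.d_le_2[of "f i" "f j"] EG.d_0[of "f i" "f j"] f_lt ij by (auto simp: EG.B_def)
    moreover have "f i = f j \<longleftrightarrow> i = j"
      using bij_betw_imp_inj_on[OF f] ij by (auto dest: inj_onD)
    ultimately show ?thesis using fB[OF ij] by simp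
  qed
  have vs': "bij_betw ((!) vs) {..<?n} (verts G)" and ws': "bij_betw ((!) ws) {..<?m} (verts H)"
    using vs ws by (auto simp: vertex_enum_def intro: bij_betw_nth)
  define h where "h = (!) vs \<circ> (f \<circ> the_inv_into {..<?m} ((!) ws))"
  have "bij_betw h (verts H) (verts G)"
    unfolding h_def by (intro bij_betw_trans[OF _ vs'] bij_betw_trans[OF _ f] bij_betw_the_inv_into ws')
  moreover have hw: "h (ws ! i) = vs ! f i" if "i < ?m" for i
    using bij_betw_imp_inj_on[OF ws'] that by (simp add: h_def the_inv_into_f_f)
  moreover have "(u, v) \<in> arcs_ends H \<longleftrightarrow> (h u, h v) \<in> arcs_ends G"
    if uv: "u \<in> verts H" "v \<in> verts H" for u v
  proof -
    obtain i j where ij: "i < ?m" "j < ?m" "u = ws ! i" "v = ws ! j"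
      using uv ws by (metis in_set_conv_nth vertex_enum_def)
    have "vs ! f i \<in> verts G" "vs ! f j \<in> verts G"
      using bij_betwE[OF vs'] f_lt ij(1,2) by blast+
    then show ?thesis
      using fd[OF ij(1,2)] H.graph_dist_eq_1_iff[OF uv] G.graph_dist_eq_1_iff ij hw by metis
  qed
  ultimately show ?thesis using digraph_isoI[OF assms(1,4)] by blast
qed

end
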